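(* Let $\alpha\in(0,1)$ and $\lambda\in\mathbb{C}$, and let $f:\mathbb{C}\to\mathbb{C}$ satisfy $f(0)=0$ and be Lipschitz with constant $L$. Assume that the origin is asymptotically stable for the test equation $y^{(\alpha)}=\lambda y$, i.e. $\lambda\in\Lambda_\alpha=\{z\in\mathbb{C}\setminus\{0\}:|\arg(z)|>\alpha\frac{\pi}{2}\}$, and, moreover, that $$L\,\rho_\alpha^\lambda<\frac12,\qquad \rho_\alpha^\lambda:=\int_0^\infty t^{\alpha-1}\left|E_{\alpha,\alpha}(\lambda t^\alpha)\right|dt .$$ Then the origin is asymptotically stable for the equation $$y^{(\alpha)}=\lambda y+f(y),\qquad y(0)=y_0 .$$
   Context: $y^{(\alpha)}$ denotes the Caputo fractional derivative of order $\alpha\in(0,1)$, $y^{(\alpha)}(t)=\frac1{\Gamma(1-\alpha)}\int_0^t(t-x)^{-\alpha}y'(x)\,dx$. For $y_0\in\mathbb{C}$, the solution of $y^{(\alpha)}=\lambda y+f(y)$, $y(0)=y_0$, is the continuous function $y:[0,\infty)\to\mathbb{C}$ satisfying $$y(t)=y_0+\frac1{\Gamma(\alpha)}\int_0^t(t-x)^{\alpha-1}\big(\lambda y(x)+f(y(x))\big)\,dx,\qquad t\ge0,$$ and it also satisfies the (known) variation of constants formula $$y(t)=E_\alpha(\lambda t^\alpha)y_0+\int_0^t(t-s)^{\alpha-1}E_{\alpha,\alpha}(\lambda(t-s)^\alpha)f(y(s))\,ds .$$ The Mittag-Leffler functions are $E_{\alpha,\beta}(z)=\sum_{j\ge0}\frac{z^j}{\Gamma(\alpha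 j+\beta)}$ ($\beta>0$) and $E_\alpha=E_{\alpha,1}$. Known facts: for $\lambda\in\Lambda_\alpha$, $E_\alpha(\lambda t^\alpha)=O(t^{-\alpha})$ and $t^{\alpha-1}E_{\alpha,\alpha}(\lambda t^\alpha)=O(t^{-\alpha-1})$ as $t\to\infty$, so that $\rho_\alpha^\lambda<\infty$. The origin is called asymptotically stable if (i) it is stable: for every $\varepsilon>0$ there is $\delta>0$ such that $|y_0|<\delta$ implies $|y(t)|<\varepsilon$ for all $t\ge0$; and (ii) it is attractive: there is $\delta_0>0$ such that $|y_0|<\delta_0$ implies $y(t)\to0$ as $t\to\infty$. *)

theory Defs
  imports "HOL-Analysis.Analysis"
begin

definition mittag_leffler :: "real \<Rightarrow> real \<Rightarrow> complex \<Rightarrow> complex" where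
  "mittag_leffler \<alpha> \<beta> z = (\<Sum>j. z ^ j / complex_of_real (Gamma (\<alpha> * real j + \<beta>)))"

text \<open>
  A solution of the Caputo problem \<open>y\<^sup>(\<^sup>\<alpha>\<^sup>) = F(y)\<close>, \<open>y(0) = y0\<close> on \<open>[0, \<infinity>)\<close> is a continuous
  solution of the equivalent Volterra integral equation. For continuous \<open>F\<close> and \<open>y\<close> the integrand
  is Lebesgue integrable on \<open>[0, t]\<close>; its value at the singular endpoint \<open>x = t\<close> is
  immaterial. Values of \<open>y\<close> at negative arguments are unconstrained.
\<close>
definition caputo_solution ::
    "real \<Rightarrow> (complex \<Rightarrow> complex) \<Rightarrow> complex \<Rightarrow> (real \<Rightarrow> complex) \<Rightarrow> bool" where
  "caputo_solution \<alpha> F y0 y \<longleftrightarrow>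
     continuous_on {0..} y \<and>
     (\<forall>t\<ge>0. y t = y0 + (1 / Gamma \<alpha>) *\<^sub>R
        (LINT x:{0..t}|lborel. ((t - x) powr (\<alpha> - 1)) *\<^sub>R F (y x)))"

text \<open>
  For Lipschitz \<open>F\<close> the solution exists and is unique on \<open>[0, \<infinity>)\<close>, so quantifying over all
  solutions \<open>y\<close> with initial value \<open>y0\<close> is the same as speaking of the solution.
\<close>
definition origin_stable :: "real \<Rightarrow> (complex \<Rightarrow> complex) \<Rightarrow> bool" where
  "origin_stable \<alpha> F \<longleftrightarrow>
     (\<forall>\<epsilon>>0. \<exists>\<delta>>0. \<forall>y0 y. norm y0 < \<delta> \<longrightarrow> caputo_solution \<alpha> F y0 y \<longrightarrow>
        (\<forall>t\<ge>0. norm (y t) < \<epsilon>))"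

definition origin_attractive :: "real \<Rightarrow> (complex \<Rightarrow> complex) \<Rightarrow> bool" where
  "origin_attractive \<alpha> F \<longleftrightarrow>
     (\<exists>\<delta>>0. \<forall>y0 y. norm y0 < \<delta> \<longrightarrow> caputo_solution \<alpha> F y0 y \<longrightarrow> (y \<longlongrightarrow> 0) at_top)"

definition origin_asymptotically_stable :: "real \<Rightarrow> (complex \<Rightarrow> complex) \<Rightarrow> bool" where
  "origin_asymptotically_stable \<alpha> F \<longleftrightarrow> origin_stable \<alpha> F \<and> origin_attractive \<alpha> F"

definition stability_sector :: "real \<Rightarrow> complex set" where
  "stability_sector \<alpha> = {z. z \<noteq> 0 \<and> \<bar>Arg z\<bar> > \<alpha> * (pi / 2)}"

text \<open>
  The integral is taken in \<open>[0, \<infinity>]\<close>, so a divergent integral has the value \<open>\<infinity>\<close>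
  rather than a default value.
\<close>
definition mittag_leffler_rho :: "real \<Rightarrow> complex \<Rightarrow> ennreal" where
  "mittag_leffler_rho \<alpha> \<mu> =
     (\<integral>\<^sup>+t\<in>{0..}. ennreal (t powr (\<alpha> - 1) *
        norm (mittag_leffler \<alpha> \<alpha> (\<mu> * complex_of_real (t powr \<alpha>)))) \<partial>lborel)"

end

theory Submission
  imports Defs "HOL-Complex_Analysis.Residue_Theorem" "HOL-Real_Asymp.Real_Asymp"
begin

text \<open>
  Write \<open>e t = E\<^sub>\<alpha>(\<mu> t\<^sup>\<alpha>)\<close> for the solution of the linear test equation with initial value \<open>1\<close> and
  \<open>R t = t\<^sup>\<alpha>\<^sup>-\<^sup>1 E\<^sub>\<alpha>\<^sub>,\<^sub>\<alpha>(\<mu> t\<^sup>\<alpha>)\<close> for the resolvent. Iterating the Volterra equation, with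
  the semigroup law of the Riemann-Liouville integrals, turns a solution \<open>y\<close> of the nonlinear
  equation into \<open>y = e y\<^sub>0 + R * f(y)\<close> (\<open>variation_of_constants\<close>). Hence
  \<open>|y| \<le> |e| |y\<^sub>0| + k * |y|\<close> with \<open>k = L |R|\<close>, a nonnegative kernel whose mass is
  below \<open>1/2\<close> by hypothesis. At a point where \<open>|y|\<close> is maximal on \<open>[0, t]\<close> this gives
  \<open>|y| \<le> 2 sup |e| |y\<^sub>0|\<close>, which is stability (\<open>convolution_inequality_bound\<close>). If moreover
  \<open>e \<rightarrow> 0\<close>, then an eventual bound \<open>b\<close> for \<open>|y|\<close> improves to \<open>3 b / 4\<close>, so \<open>y \<rightarrow> 0\<close>
  (\<open>convolution_inequality_tendsto_0\<close>).

  It remains to see that \<open>e\<close> is bounded and tends to \<open>0\<close>. For \<open>L = 0\<close> the condition on \<open>L \<rho>\<close> says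
  nothing about \<open>R\<close>, so this has to come from the position of \<open>\<mu>\<close> in the stability sector. The
  Laplace transform of \<open>e\<close> is \<open>p\<^sup>\<alpha>\<^sup>-\<^sup>1 / (p\<^sup>\<alpha> - \<mu>)\<close>. As \<open>|Arg \<mu>| > \<alpha> \<pi> / 2\<close>, the inversion
  integral can be taken along the two rays \<open>arg p = \<plusminus>\<theta>\<close> with \<open>\<theta>\<close> slightly larger than
  \<open>\<pi> / 2\<close>: to the right of them there is no zero of \<open>p\<^sup>\<alpha> - \<mu>\<close>, and on them \<open>e\<^sup>t\<^sup>p\<close> tends to \<open>0\<close>
  as \<open>t \<rightarrow> \<infinity>\<close>. Two devices keep the analysis elementary.
  \<^item> The substitution \<open>p = exp w\<close> maps the rays to the lines \<open>Im w = \<plusminus>\<theta>\<close> of a strip in which all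
    functions involved are meromorphic without branch cuts, so that the residue theorem on
    rectangles applies.
  \<^item> Subtracting \<open>1 / (p + 1)\<close>, the transform of \<open>exp (- t)\<close>, leaves an integrand of size
    \<open>O(exp (- \<alpha> |Re w|))\<close>, uniformly in \<open>t \<ge> 0\<close>. Dominated convergence then yields continuity,
    boundedness and decay in \<open>t\<close> of the inversion integral.

  The integral and \<open>e t - exp (- t)\<close> are identified by comparing Laplace transforms at large real
  arguments (\<open>laplace_injective\<close>).
\<close>

section \<open>Mittag-Leffler functions\<close>

text \<open>
  Restrict Euler's integral for \<open>\<Gamma>(a + 1)\<close> to \<open>[T, \<infinity>)\<close> and replace \<open>t\<^sup>a\<close> by \<open>T\<^sup>a\<close>. The free
  parameter \<open>T\<close> makes this a substitute for Stirling's formula: every growth estimate for the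
  Mittag-Leffler functions below comes from a choice of \<open>T\<close>.
\<close>

lemma powr_exp_le_Gamma:
  fixes a T :: real
  assumes "0 \<le> a" "0 \<le> T"
  shows "T powr a * exp (- T) \<le> Gamma (a + 1)"
proof -
  have G: "((\<lambda>t. t powr a / exp t) has_integral Gamma (a + 1)) {0..}"
    using Gamma_integral_real[of "a + 1"] assms by simp
  have "((\<lambda>t. exp (- 1 * t)) has_integral exp (- 1 * T) / 1) {T..}"
    by (rule has_integral_exp_minus_to_infinity) simp
  from has_integral_mult_right[OF this, of "T powr a"]
  have "((\<lambda>t. T powr a * exp (- t)) has_integral T powr a * exp (- T)) {T..}"
    by simp
  then have E: "((\<lambda>t. if t \<in> {T..} then T powr a * exp (- t) else 0)
      has_integral T powr a * exp (- T)) {0..}"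
    by (subst has_integral_restrict) (use assms in auto)
  show ?thesis
  proof (rule has_integral_le[OF E G])
    fix t :: real
    assume "t \<in> {0..}"
    then show "(if t \<in> {T..} then T powr a * exp (- t) else 0) \<le> t powr a / exp t"
      using assms by (auto simp: exp_minus field_simps intro!: powr_mono2)
  qed
qed

lemma Gamma_real_plus1: "0 < a \<Longrightarrow> Gamma (a + 1) = a * Gamma (a :: real)"
  by (rule Gamma_plus1) (auto elim!: nonpos_Ints_cases)

lemma inverse_Gamma_le:
  fixes b T :: real
  assumes "0 < b" "0 < T"
  shows "1 / Gamma b \<le> b * exp T * T powr (- b)"
proof -
  have "Gamma (b + 1) = b * Gamma b"
    using assms by (intro Gamma_real_plus1)
  moreover have "T powr b * exp (- T) \<le> Gamma (b + 1)"
    using assms by (intro powr_exp_le_Gamma) auto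
  ultimately have "T powr b * exp (- T) \<le> b * Gamma b" by simp
  moreover have "0 < Gamma b" using assms by (intro Gamma_real_pos)
  moreover have "0 < T powr b" using assms by simp
  ultimately show ?thesis
    by (simp add: powr_minus exp_minus field_simps)
qed

text \<open>
  With \<open>T\<^sup>\<alpha> = 2 (r + 1)\<close> the bound on \<open>1 / \<Gamma>\<close> makes the \<open>j\<close>-th term \<open>O(j / 2\<^sup>j)\<close>.
\<close>

lemma summable_mittag_leffler_norm:
  fixes \<alpha> \<beta> r :: real
  assumes "0 < \<alpha>" "0 < \<beta>" "0 \<le> r"
  shows "summable (\<lambda>j. r ^ j / Gamma (\<alpha> * real j + \<beta>))"
proof -
  define T where "T = (2 * (r + 1)) powr (1 / \<alpha>)"
  have T: "0 < T" "T powr \<alpha> = 2 * (r + 1)"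
    using assms by (auto simp: T_def powr_powr)
  define K where "K = (\<alpha> + \<beta>) * exp T * T powr (- \<beta>)"
  have "summable (\<lambda>j. K * (of_nat (Suc j) * (1/2::real) ^ j))"
    by (intro summable_mult sums_summable[OF geometric_deriv_sums]) simp
  then show ?thesis
  proof (rule summable_comparison_test'[where N = 0])
    fix j :: nat
    have b: "0 < \<alpha> * real j + \<beta>" using assms by (simp add: add_nonneg_pos)
    have "r ^ j / Gamma (\<alpha> * real j + \<beta>) \<le>
        r ^ j * ((\<alpha> * real j + \<beta>) * exp T * T powr (- (\<alpha> * real j + \<beta>)))"
      using mult_left_mono[OF inverse_Gamma_le[OF b T(1)], of "r ^ j"] assms by simp
    also have "T powr (- (\<alpha> * real j + \<beta>)) = T powr (- \<beta>) / (2 * (r + 1)) ^ j"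
    proof -
      have "T powr (\<alpha> * real j) = (2 * (r + 1)) ^ j"
        using T assms by (simp flip: powr_powr add: powr_realpow)
      moreover have "T powr (- (\<alpha> * real j + \<beta>)) = T powr (- \<beta>) / T powr (\<alpha> * real j)"
        by (simp add: algebra_simps flip: powr_diff)
      ultimately show ?thesis by simp
    qed
    also have "r ^ j * ((\<alpha> * real j + \<beta>) * exp T * (T powr (- \<beta>) / (2 * (r + 1)) ^ j))
        = (\<alpha> * real j + \<beta>) * (exp T * T powr (- \<beta>)) * (r / (2 * (r + 1))) ^ j"
      by (simp add: power_divide)
    also have "\<dots> \<le> ((\<alpha> + \<beta>) * real (Suc j)) * (exp T * T powr (- \<beta>)) * (1 / 2) ^ j"
      using assms by (intro mult_mono power_mono) (auto simp: field_simps)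
    finally show "norm (r ^ j / Gamma (\<alpha> * real j + \<beta>)) \<le> K * (of_nat (Suc j) * (1/2) ^ j)"
      using assms b by (simp add: K_def mult_ac Gamma_real_pos less_imp_le)
  qed
qed

lemma summable_mittag_leffler:
  assumes "0 < \<alpha>" "0 < \<beta>"
  shows "summable (\<lambda>j. norm (z ^ j / complex_of_real (Gamma (\<alpha> * real j + \<beta>))))"
proof -
  have "0 < Gamma (\<alpha> * real j + \<beta>)" for j
    using assms by (intro Gamma_real_pos add_nonneg_pos) auto
  then have "norm (z ^ j / complex_of_real (Gamma (\<alpha> * real j + \<beta>)))
      = norm z ^ j / Gamma (\<alpha> * real j + \<beta>)" for j
    by (simp add: norm_divide norm_power abs_of_pos)
  then show ?thesis
    using summable_mittag_leffler_norm[OF assms, of "norm z"] by simp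
qed

lemma continuous_mittag_leffler:
  assumes "0 < \<alpha>" "0 < \<beta>"
  shows "continuous_on A (mittag_leffler \<alpha> \<beta>)"
proof -
  define c where "c j = 1 / complex_of_real (Gamma (\<alpha> * real j + \<beta>))" for j
  have "isCont (\<lambda>x. \<Sum>n. c n * x ^ n) z" for z
    by (rule isCont_powser_converges_everywhere)
      (use summable_norm_cancel[OF summable_mittag_leffler[OF assms]] in \<open>simp add: c_def\<close>)
  moreover have "mittag_leffler \<alpha> \<beta> = (\<lambda>z. \<Sum>n. c n * z ^ n)"
    by (auto simp: mittag_leffler_def c_def)
  ultimately show ?thesis
    by (auto intro!: continuous_at_imp_continuous_on)
qed

lemma borel_measurable_mittag_leffler:
  "0 < \<alpha> \<Longrightarrow> 0 < \<beta> \<Longrightarrow> mittag_leffler \<alpha> \<beta> \<in> borel_measurable borel"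
  by (intro borel_measurable_continuous_onI continuous_mittag_leffler)

lemma continuous_mittag_leffler_curve:
  assumes "0 < \<alpha>"
  shows "continuous_on {0..} (\<lambda>t. mittag_leffler \<alpha> 1 (\<mu> * complex_of_real (t powr \<alpha>)))"
  by (intro continuous_on_compose2[OF continuous_mittag_leffler[OF assms zero_less_one, of UNIV]]
      continuous_on_mult continuous_on_const continuous_on_of_real continuous_on_powr' continuous_on_id)
    (use assms in auto)

text \<open>
  This is \<open>powr_exp_le_Gamma\<close> at \<open>T = x t\<close>: for large \<open>x\<close> the terms of \<open>E\<^sub>\<alpha>(\<mu> t\<^sup>\<alpha>)\<close> are dominated by
  a geometric series, at the cost of the factor \<open>exp (x t)\<close>.
\<close>

lemma mittag_leffler_curve_term_le:
  fixes \<alpha> x t r :: real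
  assumes "0 < \<alpha>" "0 < x" "0 \<le> t" "0 \<le> r"
  shows "(r * t powr \<alpha>) ^ j / Gamma (\<alpha> * real j + 1) \<le> (r / x powr \<alpha>) ^ j * exp (x * t)"
proof -
  have G: "0 < Gamma (\<alpha> * real j + 1)"
    using assms by (intro Gamma_real_pos add_nonneg_pos) auto
  have "(x powr \<alpha> * t powr \<alpha>) ^ j * exp (- (x * t)) \<le> Gamma (\<alpha> * real j + 1)"
  proof (cases "t = 0")
    case True
    then show ?thesis
      using G assms by (cases j) (auto simp: less_imp_le)
  next
    case False
    then have "(x powr \<alpha> * t powr \<alpha>) ^ j = (x * t) powr (\<alpha> * real j)"
      using assms by (simp add: powr_mult powr_powr[symmetric] powr_realpow power_mult_distrib)
    then show ?thesis
      using powr_exp_le_Gamma[of "\<alpha> * real j" "x * t"] assms by simp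
  qed
  then have "(x powr \<alpha> * t powr \<alpha>) ^ j / Gamma (\<alpha> * real j + 1) \<le> exp (x * t)"
    using G by (simp add: exp_minus field_simps)
  then have "(r / x powr \<alpha>) ^ j * ((x powr \<alpha> * t powr \<alpha>) ^ j / Gamma (\<alpha> * real j + 1))
      \<le> (r / x powr \<alpha>) ^ j * exp (x * t)"
    using assms by (intro mult_left_mono) auto
  moreover have "(r / x powr \<alpha>) ^ j * (x powr \<alpha> * t powr \<alpha>) ^ j = (r * t powr \<alpha>) ^ j"
    using assms by (simp flip: power_mult_distrib)
  ultimately show ?thesis by simp
qed

lemma mittag_leffler_exp_bound:
  assumes "0 < \<alpha>" "0 < x" "2 * norm \<mu> \<le> x powr \<alpha>" "0 \<le> t"
  shows "norm (mittag_leffler \<alpha> 1 (\<mu> * complex_of_real (t powr \<alpha>))) \<le> 2 * exp (x * t)"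
proof -
  define a where "a j = (\<mu> * complex_of_real (t powr \<alpha>)) ^ j / complex_of_real (Gamma (\<alpha> * real j + 1))" for j
  have G: "0 < Gamma (\<alpha> * real j + 1)" for j
    using assms by (intro Gamma_real_pos add_nonneg_pos) auto
  have le: "norm (a j) \<le> (1/2) ^ j * exp (x * t)" for j
  proof -
    have "norm (a j) = (norm \<mu> * t powr \<alpha>) ^ j / Gamma (\<alpha> * real j + 1)"
      using G[of j] by (simp add: a_def norm_divide norm_power norm_mult)
    also have "\<dots> \<le> (norm \<mu> / x powr \<alpha>) ^ j * exp (x * t)"
      using assms by (intro mittag_leffler_curve_term_le) auto
    also have "\<dots> \<le> (1/2) ^ j * exp (x * t)"
      using assms by (intro mult_right_mono power_mono) (auto simp: field_simps)
    finally show ?thesis .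
  qed
  have s: "(\<lambda>j. (1/2) ^ j * exp (x * t)) sums (2 * exp (x * t))"
    using sums_mult2[OF geometric_sums[of "1/2 :: real"], of "exp (x * t)"] by simp
  have "norm (\<Sum>j. a j) \<le> (\<Sum>j. (1/2) ^ j * exp (x * t))"
    using le by (intro norm_suminf_le sums_summable[OF s])
  then show ?thesis
    using sums_unique[OF s] by (simp add: mittag_leffler_def a_def)
qed

lemma has_bochner_integral_powr_exp:
  fixes a x :: real
  assumes "0 \<le> a" "0 < x"
  shows "has_bochner_integral lborel (\<lambda>t. indicator {0..} t * (exp (- x * t) * t powr a))
           (Gamma (a + 1) / x powr (a + 1))"
proof -
  let ?g = "\<lambda>t::real. indicator {0..} t * t powr a / exp t"
  have *: "has_bochner_integral lborel ?g (Gamma (a + 1))"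
  proof (rule has_bochner_integral_nn_integral)
    show "(\<integral>\<^sup>+ t. ennreal (?g t) \<partial>lborel) = ennreal (Gamma (a + 1))"
      using Gamma_conv_nn_integral_real[of "a + 1"] assms by simp
    show "0 \<le> Gamma (a + 1)"
      using assms by (simp add: Gamma_real_pos less_imp_le)
  qed auto
  have i: "integrable lborel (\<lambda>t. ?g (0 + x * t))"
    using * assms by (intro lborel_integrable_real_affine) (auto simp: has_bochner_integral_iff)
  have e: "Gamma (a + 1) = x * (LINT t|lborel. ?g (0 + x * t))"
    using lborel_integral_real_affine[of x ?g 0] * assms
    by (simp add: has_bochner_integral_iff)
  have eq: "?g (0 + x * t) = x powr a * (indicator {0..} t * (exp (- x * t) * t powr a))" for t
    using assms by (auto simp: indicator_def powr_mult exp_minus divide_simps zero_le_mult_iff)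
  have "integrable lborel (\<lambda>t. indicator {0..} t * (exp (- x * t) * t powr a))"
    using i assms unfolding eq by (subst (asm) integrable_mult_left_iff) auto
  moreover have "Gamma (a + 1) = x * (x powr a * (LINT t|lborel. indicator {0..} t * (exp (- x * t) * t powr a)))"
    using e unfolding eq by simp
  ultimately show ?thesis
    using assms by (simp add: has_bochner_integral_iff powr_add field_simps)
qed

text \<open>
  Termwise integration turns the Mittag-Leffler series into a geometric series in \<open>\<mu> / x\<^sup>\<alpha>\<close>; the
  same computation with absolute values justifies the interchange.
\<close>

lemma laplace_mittag_leffler:
  fixes \<alpha> x :: real and \<mu> :: complex
  assumes "0 < \<alpha>" "0 < x" "norm \<mu> < x powr \<alpha>"
  shows "has_bochner_integral lborel
     (\<lambda>t. indicator {0..} t *\<^sub>R (exp (- x * t) *\<^sub>R mittag_leffler \<alpha> 1 (\<mu> * complex_of_real (t powr \<alpha>))))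
     (complex_of_real (x powr \<alpha> / x) / (complex_of_real (x powr \<alpha>) - \<mu>))"
proof -
  define c where "c j = \<mu> ^ j / complex_of_real (Gamma (\<alpha> * real j + 1))" for j
  define p where "p j t = indicator {0..} t * (exp (- x * t) * t powr (\<alpha> * real j))" for j t
  define q where "q = norm \<mu> / x powr \<alpha>"
  have G: "0 < Gamma (\<alpha> * real j + 1)" for j
    using assms by (intro Gamma_real_pos add_nonneg_pos) auto
  have q: "0 \<le> q" "q < 1" using assms by (auto simp: q_def)
  have p: "has_bochner_integral lborel (p j) (Gamma (\<alpha> * real j + 1) / (x * (x powr \<alpha>) ^ j))" for j
    using has_bochner_integral_powr_exp[of "\<alpha> * real j" x] assms
    by (simp add: p_def[abs_def] powr_add powr_realpow mult_ac flip: powr_powr)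
  have p0: "0 \<le> p j t" for j t by (simp add: p_def)
  define F where "F j t = p j t *\<^sub>R c j" for j t
  have Fint: "integrable lborel (F j)" and Fval: "integral\<^sup>L lborel (F j) = (1 / x) *\<^sub>R (\<mu> / complex_of_real (x powr \<alpha>)) ^ j" for j
  proof -
    show "integrable lborel (F j)"
      using p[of j] unfolding F_def[abs_def] has_bochner_integral_iff by (intro integrable_scaleR_left) auto
    have "integral\<^sup>L lborel (F j) = (Gamma (\<alpha> * real j + 1) / (x * (x powr \<alpha>) ^ j)) *\<^sub>R c j"
      using p[of j] unfolding F_def[abs_def] has_bochner_integral_iff by simp
    also have "\<dots> = (1 / x) *\<^sub>R (\<mu> / complex_of_real (x powr \<alpha>)) ^ j"
      using G[of j] by (simp add: c_def scaleR_conv_of_real power_divide)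
    finally show "integral\<^sup>L lborel (F j) = (1 / x) *\<^sub>R (\<mu> / complex_of_real (x powr \<alpha>)) ^ j" .
  qed
  have Fsum: "F j t = indicator {0..} t *\<^sub>R (exp (- x * t) *\<^sub>R ((\<mu> * complex_of_real (t powr \<alpha>)) ^ j / complex_of_real (Gamma (\<alpha> * real j + 1))))"
    if "t \<noteq> 0" for j t
    using that by (cases "t > 0") (auto simp: F_def p_def c_def scaleR_conv_of_real power_mult_distrib
        powr_realpow indicator_def simp flip: powr_powr)
  have AE0: "AE t in lborel. t \<noteq> (0::real)"
    by (rule AE_lborel_singleton)
  have 1: "AE t in lborel. summable (\<lambda>j. norm (F j t))"
    using AE0
  proof eventually_elim
    case (elim t)
    show ?case
      unfolding Fsum[OF elim] norm_scaleR
      by (intro summable_mult summable_mittag_leffler) (use assms in auto)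
  qed
  have nF: "integral\<^sup>L lborel (\<lambda>t. norm (F j t)) = (1 / x) * q ^ j" for j
    using p[of j] p0 G[of j] assms 
    by (simp add: F_def has_bochner_integral_iff c_def norm_divide norm_power q_def field_simps)
  have 2: "summable (\<lambda>j. integral\<^sup>L lborel (\<lambda>t. norm (F j t)))"
    unfolding nF using q by (intro summable_mult summable_geometric) auto
  have sumF: "(\<Sum>j. F j t) = indicator {0..} t *\<^sub>R (exp (- x * t) *\<^sub>R mittag_leffler \<alpha> 1 (\<mu> * complex_of_real (t powr \<alpha>)))"
    if "t \<noteq> 0" for t
    unfolding Fsum[OF that] mittag_leffler_def
    by (subst suminf_scaleR_right[symmetric] | 
        (intro summable_scaleR_right summable_norm_cancel[OF summable_mittag_leffler] assms zero_less_one))+ simp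
  have "(\<lambda>j. (1 / x) *\<^sub>R (\<mu> / complex_of_real (x powr \<alpha>)) ^ j) sums
      ((1 / x) *\<^sub>R (1 / (1 - \<mu> / complex_of_real (x powr \<alpha>))))"
    using assms by (intro sums_scaleR_right geometric_sums) (auto simp: norm_divide)
  moreover have "(1 / x) *\<^sub>R (1 / (1 - \<mu> / complex_of_real (x powr \<alpha>)))
      = complex_of_real (x powr \<alpha> / x) / (complex_of_real (x powr \<alpha>) - \<mu>)"
    using assms by (auto simp: scaleR_conv_of_real field_simps)
  ultimately have "has_bochner_integral lborel (\<lambda>t. \<Sum>j. F j t)
     (complex_of_real (x powr \<alpha> / x) / (complex_of_real (x powr \<alpha>) - \<mu>))"
    using integrable_suminf[OF Fint 1 2] sums_integral[OF Fint 1 2] unfolding Fval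
    by (auto simp: has_bochner_integral_iff dest: sums_unique2)
  then show ?thesis
  proof (rule has_bochner_integral_cong_AE[THEN iffD1, rotated -1])
    show "AE t in lborel. (\<Sum>j. F j t) = indicator {0..} t *\<^sub>R (exp (- x * t) *\<^sub>R mittag_leffler \<alpha> 1 (\<mu> * complex_of_real (t powr \<alpha>)))"
      using AE0 by eventually_elim (rule sumF)
    show "(\<lambda>t. \<Sum>j. F j t) \<in> borel_measurable lborel"
      using Fint by (intro borel_measurable_suminf borel_measurable_integrable)
    note [measurable] = borel_measurable_mittag_leffler[OF assms(1) zero_less_one]
    show "(\<lambda>t. indicator {0..} t *\<^sub>R (exp (- x * t) *\<^sub>R mittag_leffler \<alpha> 1 (\<mu> * complex_of_real (t powr \<alpha>)))) \<in> borel_measurable lborel"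
      by measurable
  qed
qed

section \<open>Injectivity of the Laplace transform\<close>

lemma has_bochner_integral_exp_minus:
  fixes x :: real
  assumes "0 < x"
  shows "has_bochner_integral lborel (\<lambda>t. indicator {0..} t * exp (- x * t)) (1 / x)"
proof (rule has_bochner_integral_cong_AE[THEN iffD1])
  show "has_bochner_integral lborel (\<lambda>t. indicator {0..} t * (exp (- x * t) * t powr 0)) (1 / x)"
    using has_bochner_integral_powr_exp[of 0 x] assms by simp
qed (auto intro!: AE_I[where N = "{0}"] simp: indicator_def)

text \<open>
  Lerch's theorem. The hypothesis at \<open>x = s + 2, s + 3, \<dots>\<close> says that
  \<open>w t = exp (- (s + 1) t) d t\<close> is orthogonal to all polynomials in \<open>exp (- t)\<close> with respect to the
  weight \<open>exp (- t)\<close>. By the Weierstrass theorem such polynomials approximate \<open>w\<close> itself, so the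
  weighted integral of \<open>w\<^sup>2\<close> vanishes.
\<close>

lemma laplace_injective_real:
  fixes d :: "real \<Rightarrow> real"
  assumes cont: "continuous_on {0..} d"
    and bound: "\<And>t. 0 \<le> t \<Longrightarrow> \<bar>d t\<bar> \<le> C * exp (s * t)"
    and zero: "\<And>x. s < x \<Longrightarrow> (LINT t|lborel. indicator {0..} t * (exp (- x * t) * d t)) = 0"
    and "0 \<le> t"
  shows "d t = 0"
proof -
  define w where "w t = exp (- (s + 1) * t) * d t" for t
  have w_cont: "continuous_on {0..} w"
    unfolding w_def by (intro continuous_intros cont)
  have w_bound: "\<bar>w t\<bar> \<le> C * exp (- t)" if "0 \<le> t" for t
  proof -
    have "\<bar>w t\<bar> \<le> exp (- (s + 1) * t) * (C * exp (s * t))"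
      unfolding w_def abs_mult using bound[OF that] by (intro mult_mono) auto
    also have "\<dots> = C * exp (- t)"
      by (simp add: algebra_simps flip: exp_add)
    finally show ?thesis .
  qed
  have C: "0 \<le> C" using w_bound[of 0] by simp
  have w_meas: "(\<lambda>t. indicator {0..} t * w t) \<in> borel_measurable lborel"
    using borel_measurable_continuous_on_indicator[OF _ w_cont] by simp
  have e_int: "has_bochner_integral lborel (\<lambda>t. indicator {0..} t * exp (- t)) (1 :: real)"
    using has_bochner_integral_exp_minus[of 1] by simp
  have dom: "integrable lborel (\<lambda>t. indicator {0..} t * (exp (- t) * (w t * g t)))"
    if g: "(\<lambda>t. indicator {0..} t * g t) \<in> borel_measurable lborel" "\<And>t. 0 \<le> t \<Longrightarrow> \<bar>g t\<bar> \<le> B" for g B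
  proof (rule Bochner_Integration.integrable_bound)
    show "integrable lborel (\<lambda>t. C * B * (indicator {0..} t * exp (- t)))"
      using e_int by (intro integrable_mult_right) (auto simp: has_bochner_integral_iff)
    have "(\<lambda>t. exp (- t) * ((indicator {0..} t * w t) * (indicator {0..} t * g t))) \<in> borel_measurable lborel"
      using w_meas g(1) by measurable
    also have "(\<lambda>t. exp (- t) * ((indicator {0..} t * w t) * (indicator {0..} t * g t))) = (\<lambda>t. indicator {0..} t * (exp (- t) * (w t * g t)))"
      by (auto simp: indicator_def fun_eq_iff)
    finally show "\<dots> \<in> borel_measurable lborel" .
    show "AE t in lborel. norm (indicator {0..} t * (exp (- t) * (w t * g t))) \<le> norm (C * B * (indicator {0..} t * exp (- t)))"
    proof (rule AE_I2)
      fix t :: real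
      show "norm (indicator {0..} t * (exp (- t) * (w t * g t))) \<le> norm (C * B * (indicator {0..} t * exp (- t)))"
      proof (cases "0 \<le> t")
        case True
        have "0 \<le> B" using g(2)[OF True] by simp
        have "\<bar>w t\<bar> \<le> C"
          using w_bound[OF True] mult_left_mono[of "exp (- t)" 1 C] C True by simp
        then have "\<bar>w t\<bar> * \<bar>g t\<bar> \<le> C * B"
          using g(2)[OF True] C by (intro mult_mono) auto
        then show ?thesis
          using True C \<open>0 \<le> B\<close> by (simp add: abs_mult mult.commute[of _ "exp (-t)"])
      qed simp
    qed
  qed
  have w_le: "\<bar>w t\<bar> \<le> C" if "0 \<le> t" for t
    using w_bound[OF that] mult_left_mono[of "exp (- t)" 1 C] C that by simp
  \<comment> \<open>Substituting \<open>u = exp (- t)\<close> carries \<open>w\<close> to a continuous function on the compact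
    interval \<open>[0, 1]\<close>, with value \<open>0\<close> at the point \<open>u = 0\<close> that corresponds to \<open>t = \<infinity>\<close>.\<close>
  define h where "h u = (if u = 0 then 0 else w (- ln u))" for u
  have h_cont: "continuous_on {0..1} h"
    unfolding continuous_on_eq_continuous_within
  proof
    fix u :: real
    assume u: "u \<in> {0..1}"
    show "continuous (at u within {0..1}) h"
    proof (cases "u = 0")
      case False
      have c: "continuous_on {0<..1} (\<lambda>u. w (- ln u))"
        by (rule continuous_on_compose2[OF w_cont]) (auto intro!: continuous_intros)
      have "continuous_on {0<..1} h"
        by (rule continuous_on_cong[THEN iffD1, OF refl _ c]) (auto simp: h_def)
      then have "continuous (at u within {0<..1}) h"
        using u False by (auto simp: continuous_on_eq_continuous_within)
      moreover have "at u within {0<..1} = at u within {0..1}"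
      proof (rule at_within_nhd[where S = "{0<..}"])
        show "u \<in> {0<..}" using u False by auto
      qed auto
      ultimately show ?thesis by simp
    next
      case True
      have "(h \<longlongrightarrow> 0) (at 0 within {0..1})"
      proof (rule Lim_null_comparison)
        show "\<forall>\<^sub>F v in at 0 within {0..1}. norm (h v) \<le> C * v"
          unfolding eventually_at_filter
        proof (intro always_eventually allI impI)
          fix v :: real
          assume "v \<noteq> 0" "v \<in> {0..1}"
          then show "norm (h v) \<le> C * v"
            using w_bound[of "- ln v"] by (simp add: h_def)
        qed
        show "((\<lambda>v. C * v) \<longlongrightarrow> 0) (at 0 within {0..1})"
          by (auto intro!: tendsto_eq_intros)
      qed
      then show ?thesis
        using True by (simp add: continuous_within h_def)
    qed
  qed
  have moments: "(LINT t|lborel. indicator {0..} t * (exp (- t) * (w t * g (exp (- t))))) = 0"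
    if poly: "real_polynomial_function g" for g
  proof -
    obtain a n where g: "g = (\<lambda>x. \<Sum>i\<le>n. a i * x ^ i)"
      using poly unfolding real_polynomial_function_iff_sum by blast
    have eq: "indicator {0..} t * (exp (- t) * (w t * g (exp (- t)))) =
        (\<Sum>i\<le>n. a i * (indicator {0..} t * (exp (- t) * (w t * exp (- t) ^ i))))" for t
      by (simp add: g sum_distrib_left mult_ac)
    have "integrable lborel (\<lambda>t. indicator {0..} t * (exp (- t) * (w t * exp (- t) ^ i)))" for i
      by (rule dom[where B = 1]) (auto simp: power_le_one)
    moreover have "(LINT t|lborel. indicator {0..} t * (exp (- t) * (w t * exp (- t) ^ i))) = 0" for i
    proof -
      have "exp (- t) * (w t * exp (- t) ^ i) = exp (- (s + 2 + real i) * t) * d t" for t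
        by (simp add: w_def algebra_simps flip: exp_of_nat_mult exp_add)
      then show ?thesis
        using zero[of "s + 2 + real i"] by simp
    qed
    ultimately show ?thesis
      unfolding eq by (subst Bochner_Integration.integral_sum) auto
  qed
  define I where "I = (LINT t|lborel. indicator {0..} t * (exp (- t) * (w t * w t)))"
  have w2_int: "integrable lborel (\<lambda>t. indicator {0..} t * (exp (- t) * (w t * w t)))"
    using w_le by (intro dom[where B = C] w_meas)
  have "I \<le> 0"
  proof (rule field_le_epsilon)
    fix e :: real
    assume "0 < e"
    then have e': "0 < e / (C + 1)" using C by simp
    obtain g where g: "real_polynomial_function g" "\<And>u. u \<in> {0..1} \<Longrightarrow> \<bar>h u - g u\<bar> < e / (C + 1)"
      using Stone_Weierstrass_real_polynomial_function[OF _ h_cont e'] by auto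
    have g_meas: "g \<in> borel_measurable borel"
      using g(1) by (intro borel_measurable_continuous_onI continuous_on_polymonial_function)
        (auto simp: real_polynomial_function_eq)
    have gw: "\<bar>w t - g (exp (- t))\<bar> \<le> e / (C + 1)" if "0 \<le> t" for t
      using g(2)[of "exp (- t)"] that by (simp add: h_def)
    have g_int: "integrable lborel (\<lambda>t. indicator {0..} t * (exp (- t) * (w t * g (exp (- t)))))"
    proof (rule dom[where B = "C + e / (C + 1)"])
      show "\<bar>g (exp (- t))\<bar> \<le> C + e / (C + 1)" if "0 \<le> t" for t
        using gw[OF that] w_le[OF that] by linarith
      show "(\<lambda>t. indicator {0..} t * g (exp (- t))) \<in> borel_measurable lborel"
        using g_meas by measurable
    qed
    have "I = (LINT t|lborel. indicator {0..} t * (exp (- t) * (w t * w t)))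
         - (LINT t|lborel. indicator {0..} t * (exp (- t) * (w t * g (exp (- t)))))"
      using moments[OF g(1)] by (simp add: I_def)
    also have "\<dots> = (LINT t|lborel. indicator {0..} t * (exp (- t) * (w t * w t)) - indicator {0..} t * (exp (- t) * (w t * g (exp (- t)))))"
      by (rule Bochner_Integration.integral_diff[symmetric, OF w2_int g_int])
    also have "\<dots> \<le> (LINT t|lborel. e * (indicator {0..} t * exp (- t)))"
    proof (rule integral_mono)
      show "integrable lborel (\<lambda>t. e * (indicator {0..} t * exp (- t)))"
        using e_int by (intro integrable_mult_right) (auto simp: has_bochner_integral_iff)
      show "integrable lborel (\<lambda>t. indicator {0..} t * (exp (- t) * (w t * w t)) - indicator {0..} t * (exp (- t) * (w t * g (exp (- t)))))"
        using w2_int g_int by (rule Bochner_Integration.integrable_diff)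
      fix t :: real
      have "w t * (w t - g (exp (- t))) \<le> e" if "0 \<le> t"
      proof -
        have "w t * (w t - g (exp (- t))) \<le> \<bar>w t\<bar> * \<bar>w t - g (exp (- t))\<bar>"
          by (simp flip: abs_mult)
        also have "\<dots> \<le> C * (e / (C + 1))"
          using w_le[OF that] gw[OF that] C by (intro mult_mono) auto
        also have "\<dots> \<le> e"
          using C \<open>0 < e\<close> by (simp add: field_simps)
        finally show ?thesis .
      qed
      then have "0 \<le> t \<Longrightarrow> exp (- t) * (w t * (w t - g (exp (- t)))) \<le> exp (- t) * e"
        by (intro mult_left_mono) auto
      then show "indicator {0..} t * (exp (- t) * (w t * w t)) - indicator {0..} t * (exp (- t) * (w t * g (exp (- t)))) \<le> e * (indicator {0..} t * exp (- t))"
        by (auto simp: indicator_def algebra_simps)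
    qed
    also have "\<dots> = e"
      using e_int by (simp add: has_bochner_integral_iff)
    finally show "I \<le> 0 + e" by simp
  qed
  have cont2: "continuous_on {0..t + 1} (\<lambda>t. exp (- t) * (w t * w t))"
    by (intro continuous_intros continuous_on_subset[OF w_cont]) auto
  have "integral {0..t + 1} (\<lambda>t. exp (- t) * (w t * w t)) = 0"
  proof -
    have "set_integrable lborel {0..t + 1} (\<lambda>t. exp (- t) * (w t * w t))"
      using borel_integrable_atLeastAtMost'[OF cont2] .
    then have "integral {0..t + 1} (\<lambda>t. exp (- t) * (w t * w t)) = (LINT t:{0..t + 1}|lborel. exp (- t) * (w t * w t))"
      by (rule set_borel_integral_eq_integral(2)[symmetric])
    also have "\<dots> \<le> I"
      unfolding I_def set_lebesgue_integral_def
    proof (rule integral_mono)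
      show "integrable lborel (\<lambda>u. indicator {0..t + 1} u *\<^sub>R (exp (- u) * (w u * w u)))"
        using borel_integrable_atLeastAtMost'[OF cont2] by (simp add: set_integrable_def)
    qed (use w2_int in \<open>auto simp: indicator_def\<close>)
    finally show ?thesis
      using \<open>I \<le> 0\<close> integral_nonneg[OF integrable_continuous_interval[OF cont2]] by fastforce
  qed
  then have "exp (- t) * (w t * w t) = 0"
    using integral_eq_0_iff[of 0 "t + 1" "\<lambda>t. exp (- t) * (w t * w t)"] cont2 \<open>0 \<le> t\<close>
    by auto
  then show ?thesis by (simp add: w_def)
qed

lemma laplace_injective:
  fixes d :: "real \<Rightarrow> complex"
  assumes cont: "continuous_on {0..} d"
    and bound: "\<And>t. 0 \<le> t \<Longrightarrow> norm (d t) \<le> C * exp (s * t)"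
    and zero: "\<And>x. s < x \<Longrightarrow> has_bochner_integral lborel (\<lambda>t. indicator {0..} t *\<^sub>R (exp (- x * t) *\<^sub>R d t)) 0"
    and "0 \<le> t"
  shows "d t = 0"
proof (rule complex_eqI)
  show "Re (d t) = Re 0"
    unfolding zero_complex.sel
  proof (rule laplace_injective_real[where d = "\<lambda>t. Re (d t)" and C = C and s = s])
    show "(LINT t|lborel. indicator {0..} t * (exp (- x * t) * Re (d t))) = 0" if "s < x" for x
      using has_bochner_integral_bounded_linear[OF bounded_linear_Re zero[OF that]]
      by (simp add: has_bochner_integral_iff mult.assoc)
  qed (use assms abs_Re_le_cmod order_trans in \<open>blast intro: continuous_intros\<close>)+
  show "Im (d t) = Im 0"
    unfolding zero_complex.sel
  proof (rule laplace_injective_real[where d = "\<lambda>t. Im (d t)" and C = C and s = s])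
    show "(LINT t|lborel. indicator {0..} t * (exp (- x * t) * Im (d t))) = 0" if "s < x" for x
      using has_bochner_integral_bounded_linear[OF bounded_linear_Im zero[OF that]]
      by (simp add: has_bochner_integral_iff mult.assoc)
  qed (use assms abs_Im_le_cmod order_trans in \<open>blast intro: continuous_intros\<close>)+
qed

section \<open>Decay of the Laplace symbol in a strip\<close>

lemma cos_le_cos_of_angle_gap:
  fixes \<delta> x :: real
  assumes "0 \<le> \<delta>" "\<delta> \<le> \<bar>x\<bar>" "\<bar>x\<bar> \<le> 2 * pi - \<delta>"
  shows "cos x \<le> cos \<delta>"
proof (cases "\<bar>x\<bar> \<le> pi")
  case True
  then have "cos \<bar>x\<bar> \<le> cos \<delta>" using assms by (intro cos_monotone_0_pi_le) auto
  then show ?thesis by simp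
next
  case False
  then have "cos (2 * pi - \<bar>x\<bar>) \<le> cos \<delta>" using assms by (intro cos_monotone_0_pi_le) auto
  then show ?thesis by (simp add: cos_diff)
qed

text \<open>
  On the strip the argument of \<open>exp (\<beta> w)\<close> stays away from that of \<open>\<mu>\<close> by at least
  \<open>\<delta> = |Arg \<mu>| - \<beta> \<theta>\<close>. Two complex numbers that enclose an angle of at least \<open>\<delta>\<close> have a distance
  comparable with the sum of their moduli, by the law of cosines.
\<close>

lemma exp_strip_distance:
  fixes \<beta> \<theta> :: real and \<mu> :: complex
  assumes "0 \<le> \<theta>" "0 < \<beta>" "\<mu> \<noteq> 0" "\<beta> * \<theta> < \<bar>Arg \<mu>\<bar>"
  obtains c where "0 < c"
    "\<And>w. \<bar>Im w\<bar> \<le> \<theta> \<Longrightarrow> c * (exp (\<beta> * Re w) + norm \<mu>) \<le> norm (exp (complex_of_real \<beta> * w) - \<mu>)"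
proof
  define \<delta> where "\<delta> = \<bar>Arg \<mu>\<bar> - \<beta> * \<theta>"
  have A: "\<bar>Arg \<mu>\<bar> \<le> pi" using Arg_bounded[of \<mu>] by auto
  have "0 \<le> \<beta> * \<theta>" using assms by simp
  then have \<delta>: "0 < \<delta>" "\<delta> \<le> pi" using assms A unfolding \<delta>_def by linarith+
  define k where "k = (1 - cos \<delta>) / 2"
  have "cos \<delta> < cos 0" using \<delta> by (intro cos_monotone_0_pi) auto
  then have k: "0 < k" by (simp add: k_def)
  then show "0 < sqrt k" by simp
  fix w :: complex
  assume w: "\<bar>Im w\<bar> \<le> \<theta>"
  define r \<phi> where "r = exp (\<beta> * Re w)" and "\<phi> = \<beta> * Im w"
  have 1: "exp (complex_of_real \<beta> * w) = complex_of_real r * cis \<phi>"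
    by (simp add: r_def \<phi>_def exp_eq_polar)
  have 2: "\<mu> = complex_of_real (norm \<mu>) * cis (Arg \<mu>)"
    using Arg_eq[OF assms(3)] by (simp add: cis_conv_exp)
  have "\<bar>\<phi>\<bar> \<le> \<beta> * \<theta>"
    using w assms by (simp add: \<phi>_def abs_mult)
  then have "cos (\<phi> - Arg \<mu>) \<le> cos \<delta>"
    using A assms \<delta> by (intro cos_le_cos_of_angle_gap) (auto simp: \<delta>_def)
  have "k * (r + norm \<mu>)\<^sup>2 \<le> r\<^sup>2 + (norm \<mu>)\<^sup>2 - 2 * (r * norm \<mu>) * cos \<delta>"
  proof -
    have "0 \<le> (1 + cos \<delta>) / 2 * (r - norm \<mu>)\<^sup>2"
      using cos_ge_minus_one[of \<delta>] by (intro mult_nonneg_nonneg divide_nonneg_pos) (linarith | simp)+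
    then show ?thesis
      by (simp add: k_def power2_eq_square field_simps)
  qed
  also have "\<dots> \<le> r\<^sup>2 + (norm \<mu>)\<^sup>2 - 2 * (r * norm \<mu>) * cos (\<phi> - Arg \<mu>)"
    using mult_left_mono[OF \<open>cos (\<phi> - Arg \<mu>) \<le> cos \<delta>\<close>, of "2 * (r * norm \<mu>)"] by (simp add: r_def)
  also have "\<dots> = (norm (complex_of_real r * cis \<phi> - complex_of_real (norm \<mu>) * cis (Arg \<mu>)))\<^sup>2"
  proof -
    have "(norm (complex_of_real r * cis \<phi> - complex_of_real m * cis (Arg \<mu>)))\<^sup>2
        = r\<^sup>2 * ((sin \<phi>)\<^sup>2 + (cos \<phi>)\<^sup>2) + m\<^sup>2 * ((sin (Arg \<mu>))\<^sup>2 + (cos (Arg \<mu>))\<^sup>2)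
          - 2 * (r * m) * cos (\<phi> - Arg \<mu>)" for m
      by (simp add: cmod_power2 cos_diff del: sin_cos_squared_add sin_cos_squared_add2)
        (simp add: power2_eq_square algebra_simps del: sin_cos_squared_add3)
    then show ?thesis by simp
  qed
  also have "\<dots> = (norm (exp (complex_of_real \<beta> * w) - \<mu>))\<^sup>2"
    using 1 2 by simp
  finally have "sqrt (k * (r + norm \<mu>)\<^sup>2) \<le> norm (exp (complex_of_real \<beta> * w) - \<mu>)"
    by (intro real_le_lsqrt) auto
  moreover have "sqrt (k * (r + norm \<mu>)\<^sup>2) = sqrt k * (r + norm \<mu>)"
    by (simp add: real_sqrt_mult r_def)
  ultimately show "sqrt k * (exp (\<beta> * Re w) + norm \<mu>) \<le> norm (exp (complex_of_real \<beta> * w) - \<mu>)"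
    by (simp add: r_def)
qed

text \<open>
  In the variable \<open>p = exp w\<close>, this is \<open>p\<close> times the difference of the Laplace transforms
  \<open>p\<^sup>\<alpha>\<^sup>-\<^sup>1 / (p\<^sup>\<alpha> - \<mu>)\<close> of \<open>E\<^sub>\<alpha>(\<mu> t\<^sup>\<alpha>)\<close> and \<open>1 / (p + 1)\<close> of \<open>exp (- t)\<close>. The factor \<open>p\<close> is the
  Jacobian of the substitution.
\<close>

definition ml_symbol :: "real \<Rightarrow> complex \<Rightarrow> complex \<Rightarrow> complex" where
  "ml_symbol \<alpha> \<mu> w = exp (of_real \<alpha> * w) / (exp (of_real \<alpha> * w) - \<mu>) - exp w / (exp w + 1)"

text \<open>
  Both fractions in the symbol tend to \<open>0\<close> as \<open>Re w \<rightarrow> -\<infinity>\<close> and to \<open>1\<close> as \<open>Re w \<rightarrow> \<infinity>\<close>. The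
  limits \<open>1\<close> cancel in the difference, and what remains decays at the rate \<open>\<alpha>\<close> at either end.
\<close>

lemma ml_symbol_strip:
  fixes \<alpha> \<theta> :: real and \<mu> :: complex
  assumes "0 < \<alpha>" "\<alpha> < 1" "\<mu> \<noteq> 0" "0 \<le> \<theta>" "\<theta> < pi" "\<alpha> * \<theta> < \<bar>Arg \<mu>\<bar>"
  shows ml_symbol_denominators:
      "\<And>w. \<bar>Im w\<bar> \<le> \<theta> \<Longrightarrow> exp (of_real \<alpha> * w) \<noteq> \<mu> \<and> exp w + 1 \<noteq> 0"
    and ml_symbol_decay:
      "\<exists>C\<ge>0. \<forall>w. \<bar>Im w\<bar> \<le> \<theta> \<longrightarrow> norm (ml_symbol \<alpha> \<mu> w) \<le> C * exp (- \<alpha> * \<bar>Re w\<bar>)"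
proof -
  obtain c1 where c1: "0 < c1"
    "\<And>w. \<bar>Im w\<bar> \<le> \<theta> \<Longrightarrow> c1 * (exp (\<alpha> * Re w) + norm \<mu>) \<le> norm (exp (complex_of_real \<alpha> * w) - \<mu>)"
    using exp_strip_distance[of \<theta> \<alpha> \<mu>] assms by auto
  have "Arg (- 1) = pi" by (simp add: Arg_eq_pi)
  then obtain c2 where c2: "0 < c2"
    "\<And>w. \<bar>Im w\<bar> \<le> \<theta> \<Longrightarrow> c2 * (exp (Re w) + 1) \<le> norm (exp w + 1)"
    using exp_strip_distance[of \<theta> 1 "- 1"] assms by auto
  show den: "exp (of_real \<alpha> * w) \<noteq> \<mu> \<and> exp w + 1 \<noteq> 0" if "\<bar>Im w\<bar> \<le> \<theta>" for w
  proof -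
    have "0 < c1 * (exp (\<alpha> * Re w) + norm \<mu>)" "0 < c2 * (exp (Re w) + 1)"
      using c1(1) c2(1) by (auto intro!: mult_pos_pos add_pos_nonneg)
    then show ?thesis using c1(2)[OF that] c2(2)[OF that] by auto
  qed
  define m where "m = norm \<mu>"
  have m: "0 < m" using assms by (simp add: m_def)
  define C where "C = (1 + m) * (1 + 1 / m) / (c1 * c2)"
  have "norm (ml_symbol \<alpha> \<mu> w) \<le> C * exp (- \<alpha> * \<bar>Re w\<bar>)" if w: "\<bar>Im w\<bar> \<le> \<theta>" for w
  proof -
    define a b where "a = exp (\<alpha> * Re w)" and "b = exp (Re w)"
    have ab: "0 < a" "0 < b" by (auto simp: a_def b_def)
    have "ml_symbol \<alpha> \<mu> w =
        (exp (of_real \<alpha> * w) + \<mu> * exp w) / ((exp (of_real \<alpha> * w) - \<mu>) * (exp w + 1))"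
      using den[OF w] by (simp add: ml_symbol_def field_simps)
    moreover have "norm (exp (of_real \<alpha> * w) + \<mu> * exp w) \<le> a + m * b"
      by (rule order_trans[OF norm_triangle_ineq]) (simp add: norm_mult a_def b_def m_def)
    moreover have "(c1 * (a + m)) * (c2 * (b + 1)) \<le> norm ((exp (of_real \<alpha> * w) - \<mu>) * (exp w + 1))"
      unfolding norm_mult using c1 c2 w by (intro mult_mono) (auto simp: a_def b_def m_def)
    moreover have "0 < (c1 * (a + m)) * (c2 * (b + 1))"
      using c1 c2 ab m by simp
    ultimately have "norm (ml_symbol \<alpha> \<mu> w) \<le> (a + m * b) / ((c1 * (a + m)) * (c2 * (b + 1)))"
      unfolding norm_divide using ab m by (auto simp: norm_divide intro!: frac_le)
    also have "\<dots> = (a + m * b) / ((a + m) * (b + 1)) / (c1 * c2)"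
      by simp
    also have "\<dots> \<le> (1 + m) * (1 + 1 / m) * exp (- \<alpha> * \<bar>Re w\<bar>) / (c1 * c2)"
    proof (intro divide_right_mono)
      show "(a + m * b) / ((a + m) * (b + 1)) \<le> (1 + m) * (1 + 1 / m) * exp (- \<alpha> * \<bar>Re w\<bar>)"
      proof (cases "Re w \<le> 0")
        case True
        have "b \<le> a"
          using True assms mult_right_mono_neg[of \<alpha> 1 "Re w"] by (simp add: a_def b_def)
        then have "a + m * b \<le> (1 + m) * a"
          using m by (simp add: algebra_simps)
        moreover have "m * 1 \<le> (a + m) * (b + 1)"
          using ab m by (intro mult_mono) auto
        ultimately have "(a + m * b) / ((a + m) * (b + 1)) \<le> ((1 + m) * a) / (m * 1)"
          using ab m by (intro frac_le) auto
        also have "\<dots> \<le> (1 + m) * (1 + 1 / m) * a"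
          using m ab by (simp add: field_simps)
        finally show ?thesis using True by (simp add: a_def)
      next
        case False
        have "a \<le> b"
          using False assms mult_right_mono[of \<alpha> 1 "Re w"] by (simp add: a_def b_def)
        then have "a + m * b \<le> (1 + m) * b"
          using m by (simp add: algebra_simps)
        moreover have "a * b \<le> (a + m) * (b + 1)"
          using ab m by (intro mult_mono) auto
        ultimately have "(a + m * b) / ((a + m) * (b + 1)) \<le> ((1 + m) * b) / (a * b)"
          using ab m by (intro frac_le) auto
        also have "\<dots> = (1 + m) * 1 * inverse a"
          using ab by (simp add: field_simps)
        also have "\<dots> \<le> (1 + m) * (1 + 1 / m) * inverse a"
          using m ab by (intro mult_mono) auto
        finally show ?thesis using False by (simp add: a_def exp_minus)
      qed
    qed (use c1 c2 in auto)
    finally show ?thesis by (simp add: C_def)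
  qed
  moreover have "0 \<le> C" using m c1 c2 by (simp add: C_def)
  ultimately show "\<exists>C\<ge>0. \<forall>w. \<bar>Im w\<bar> \<le> \<theta> \<longrightarrow> norm (ml_symbol \<alpha> \<mu> w) \<le> C * exp (- \<alpha> * \<bar>Re w\<bar>)"
    by blast
qed

lemma integrable_exp_neg_abs:
  fixes a :: real
  assumes "0 < a"
  shows "integrable lborel (\<lambda>u. exp (- a * \<bar>u\<bar>))"
proof (rule Bochner_Integration.integrable_bound)
  have *: "integrable lborel (\<lambda>t. indicator {0..} t * exp (- a * t))"
    using has_bochner_integral_exp_minus[OF assms] by (simp add: has_bochner_integral_iff)
  show "integrable lborel (\<lambda>u. indicator {0..} u * exp (- a * u) + indicator {0..} (0 + - 1 * u) * exp (- a * (0 + - 1 * u)))"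
    by (intro Bochner_Integration.integrable_add * lborel_integrable_real_affine[OF *]) simp
qed (auto simp: indicator_def abs_if)

text \<open>
  The horizontal sides of the rectangles below are converted to Lebesgue integrals, for which
  dominated convergence and Fubini's theorem are at hand.
\<close>

lemma contour_integral_horizontal_linepath:
  assumes "a < b" "continuous_on {a..b} (\<lambda>u. f (Complex u s))"
  shows "contour_integral (linepath (Complex a s) (Complex b s)) f
      = (LINT u|lborel. indicator {a..b} u *\<^sub>R f (Complex u s))"
proof -
  let ?l = "linepath (Complex a s) (Complex b s)"
  let ?g = "\<lambda>u. indicator {a..b} u *\<^sub>R f (Complex u s)"
  have l: "?l x = Complex (a + (b - a) * x) s" for x
    by (simp add: linepath_def complex_eq_iff algebra_simps)
  have i: "set_integrable lborel {a..b} (\<lambda>u. f (Complex u s))"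
    by (rule borel_integrable_atLeastAtMost'[OF assms(2)])
  have eq: "?g (a + (b - a) * x) = indicator {0..1} x *\<^sub>R f (?l x)" for x
  proof -
    have "a \<le> a + (b - a) * x \<longleftrightarrow> 0 \<le> x"
      using assms(1) by (simp add: zero_le_mult_iff)
    moreover have "a + (b - a) * x \<le> b \<longleftrightarrow> x \<le> 1"
    proof -
      have "(b - a) * x \<le> (b - a) * 1 \<longleftrightarrow> x \<le> 1"
        using assms(1) by (intro mult_le_cancel_left_pos) simp
      then show ?thesis by (smt (verit))
    qed
    ultimately show ?thesis
      unfolding l by (simp add: indicator_def)
  qed
  have "integral\<^sup>L lborel ?g = (b - a) *\<^sub>R (LINT x|lborel. ?g (a + (b - a) * x))"
    using lborel_integral_real_affine[of "b - a" ?g a] assms(1) by simp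
  also have "\<dots> = (b - a) *\<^sub>R (LINT x:{0..1}|lborel. f (?l x))"
    unfolding eq set_lebesgue_integral_def ..
  also have "(LINT x:{0..1}|lborel. f (?l x)) = integral {0..1} (\<lambda>x. f (?l x))"
  proof (rule set_borel_integral_eq_integral(2))
    show "set_integrable lborel {0..1} (\<lambda>x. f (?l x))"
      using lborel_integrable_real_affine[of ?g "b - a" a] i assms(1)
      unfolding eq set_integrable_def by simp
  qed
  also have "(b - a) *\<^sub>R integral {0..1} (\<lambda>x. f (?l x)) = contour_integral ?l f"
  proof -
    have "Complex b s - Complex a s = complex_of_real (b - a)"
      by (simp add: complex_eq_iff)
    then show ?thesis
      by (simp add: contour_integral_integral scaleR_conv_of_real mult.commute)
  qed
  finally show ?thesis by simp
qed

section \<open>The inversion integral\<close>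

text \<open>
  Needed for the exponentials \<open>exp (t p)\<close> with \<open>p\<close> on the contour, and for \<open>exp (- t)\<close>.
\<close>

lemma laplace_exp:
  fixes z :: complex and x :: real
  assumes "Re z < x"
  shows "has_bochner_integral lborel
     (\<lambda>t. indicator {0..} t *\<^sub>R (exp (- x * t) *\<^sub>R exp (of_real t * z))) (1 / (of_real x - z))"
proof -
  define s where "s = of_real x - z"
  have s: "0 < Re s" "s \<noteq> 0" using assms by (auto simp: s_def complex_eq_iff)
  let ?f = "\<lambda>t::real. indicator {0..} t *\<^sub>R (exp (- x * t) *\<^sub>R exp (of_real t * z))"
  have f_eq: "exp (- x * t) *\<^sub>R exp (of_real t * z) = exp (- (of_real t * s))" for t
    by (simp add: s_def scaleR_conv_of_real algebra_simps flip: exp_add exp_of_real)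
  have f_int: "integrable lborel ?f"
  proof (rule Bochner_Integration.integrable_bound)
    show "integrable lborel (\<lambda>t. indicator {0..} t * exp (- Re s * t))"
      using has_bochner_integral_exp_minus[OF s(1)] by (simp add: has_bochner_integral_iff)
    show "AE t in lborel. norm (?f t) \<le> norm (indicator {0..} t * exp (- Re s * t))"
      unfolding f_eq by (intro AE_I2) (auto simp: indicator_def mult.commute)
  qed simp
  have "((\<lambda>y. LINT t|lborel. indicator {..y} t *\<^sub>R ?f t) \<longlongrightarrow> integral\<^sup>L lborel ?f) at_top"
    by (rule tendsto_integral_at_top[OF _ f_int]) simp
  moreover have "((\<lambda>y. LINT t|lborel. indicator {..y} t *\<^sub>R ?f t) \<longlongrightarrow> 1 / s) at_top"
  proof (rule Lim_transform_eventually)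
    have "((\<lambda>y. exp (- (of_real y * s))) \<longlongrightarrow> 0) at_top"
    proof (rule Lim_null_comparison[OF always_eventually])
      show "((\<lambda>y. exp (- (y * Re s))) \<longlongrightarrow> 0) at_top" using s(1) by real_asymp
    qed simp
    then show "((\<lambda>y. (1 - exp (- (of_real y * s))) / s) \<longlongrightarrow> 1 / s) at_top"
      using s by (intro tendsto_eq_rhs[OF tendsto_divide[OF tendsto_diff[OF tendsto_const]]]) auto
    show "\<forall>\<^sub>F y in at_top. (1 - exp (- (of_real y * s))) / s = (LINT t|lborel. indicator {..y} t *\<^sub>R ?f t)"
      using eventually_ge_at_top[of 0]
    proof eventually_elim
      case (elim y)
      have "(LINT t|lborel. indicator {0..y} t *\<^sub>R exp (- (of_real t * s)))
          = - exp (- (of_real y * s)) / s - (- exp (- (of_real 0 * s)) / s)"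
      proof (rule integral_FTC_Icc[OF elim])
        show "((\<lambda>t. - exp (- (of_real t * s)) / s) has_vector_derivative exp (- (of_real t * s))) (at t within {0..y})" for t
          by (rule has_vector_derivative_real_field[where f = "\<lambda>z. - exp (- (z * s)) / s"])
            (use s in \<open>auto intro!: derivative_eq_intros\<close>)
      qed (intro continuous_intros)
      moreover have "indicator {..y} t *\<^sub>R ?f t = indicator {0..y} t *\<^sub>R exp (- (of_real t * s))" for t
        unfolding f_eq by (auto simp: indicator_def)
      ultimately show ?case by (simp add: diff_divide_distrib)
    qed
  qed
  ultimately have "integral\<^sup>L lborel ?f = 1 / s"
    using tendsto_unique[OF trivial_limit_at_top_linorder] by blast
  then show ?thesis
    using f_int by (simp add: has_bochner_integral_iff s_def)
qed

text \<open>
  The angle \<open>\<theta>\<close> of the contour: beyond \<open>\<pi> / 2\<close>, so that \<open>exp (t p)\<close> decays along the rays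
  \<open>arg p = \<plusminus>\<theta>\<close>, and small enough for the sector \<open>|arg p| \<le> \<theta>\<close> to contain neither \<open>-1\<close> nor a
  solution of \<open>p\<^sup>\<alpha> = \<mu>\<close>. Such a \<open>\<theta>\<close> exists exactly for \<open>\<mu>\<close> in the stability sector.
\<close>

locale sector_contour =
  fixes \<alpha> \<theta> :: real and \<mu> :: complex
  assumes \<alpha>: "0 < \<alpha>" "\<alpha> < 1"
    and \<mu>: "\<mu> \<noteq> 0"
    and \<theta>: "pi / 2 < \<theta>" "\<theta> < pi" "\<alpha> * \<theta> < \<bar>Arg \<mu>\<bar>"
begin

lemma \<theta>_pos: "0 < \<theta>"
  using \<theta>(1) pi_gt_zero by linarith

text \<open>
  A fixed choice of the constant in \<open>ml_symbol_decay\<close>, so that one majorant serves for all \<open>t\<close>.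
\<close>

definition decay_const :: real where
  "decay_const = (SOME C. 0 \<le> C \<and> (\<forall>w. \<bar>Im w\<bar> \<le> \<theta> \<longrightarrow> norm (ml_symbol \<alpha> \<mu> w) \<le> C * exp (- \<alpha> * \<bar>Re w\<bar>)))"

lemma decay_const_nonneg: "0 \<le> decay_const"
  and symbol_le: "\<bar>Im w\<bar> \<le> \<theta> \<Longrightarrow> norm (ml_symbol \<alpha> \<mu> w) \<le> decay_const * exp (- \<alpha> * \<bar>Re w\<bar>)"
proof -
  have "\<exists>C. 0 \<le> C \<and> (\<forall>w. \<bar>Im w\<bar> \<le> \<theta> \<longrightarrow> norm (ml_symbol \<alpha> \<mu> w) \<le> C * exp (- \<alpha> * \<bar>Re w\<bar>))"
    using ml_symbol_decay[OF \<alpha> \<mu> _ \<theta>(2,3)] \<theta>_pos by auto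
  from someI_ex[OF this] show "0 \<le> decay_const"
    "\<bar>Im w\<bar> \<le> \<theta> \<Longrightarrow> norm (ml_symbol \<alpha> \<mu> w) \<le> decay_const * exp (- \<alpha> * \<bar>Re w\<bar>)"
    unfolding decay_const_def by blast+
qed

lemma cos_\<theta>_neg: "cos \<theta> < 0"
  using cos_lt_zero_pi[of \<theta>] \<theta> pi_gt_zero by auto

lemma Re_exp_line_neg: "\<bar>s\<bar> = \<theta> \<Longrightarrow> Re (exp (Complex u s)) < 0"
  using cos_\<theta>_neg by (auto simp: Re_exp mult_pos_neg abs_if split: if_splits)

lemma symbol_measurable [measurable]: "ml_symbol \<alpha> \<mu> \<in> borel_measurable borel"
  unfolding ml_symbol_def by measurable

lemma Complex_line_measurable [measurable]: "(\<lambda>u. Complex u s) \<in> borel_measurable borel"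
  unfolding Complex_eq by measurable

lemma integrable_symbol_line:
  assumes "\<bar>s\<bar> = \<theta>" "g \<in> borel_measurable borel" "\<And>u. norm (g u) \<le> B"
  shows "integrable lborel (\<lambda>u. g u * ml_symbol \<alpha> \<mu> (Complex u s))"
proof (rule Bochner_Integration.integrable_bound)
  show "integrable lborel (\<lambda>u. B * decay_const * exp (- \<alpha> * \<bar>u\<bar>))"
    by (intro integrable_mult_right integrable_exp_neg_abs \<alpha>)
  show "(\<lambda>u. g u * ml_symbol \<alpha> \<mu> (Complex u s)) \<in> borel_measurable lborel"
    using assms(2) by measurable
  have "0 \<le> B" using assms(3)[of 0] norm_ge_zero order_trans by blast
  have "norm (g u * ml_symbol \<alpha> \<mu> (Complex u s)) \<le> norm (B * decay_const * exp (- \<alpha> * \<bar>u\<bar>))" for u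
  proof -
    have "norm (g u * ml_symbol \<alpha> \<mu> (Complex u s)) \<le> B * (decay_const * exp (- \<alpha> * \<bar>u\<bar>))"
      unfolding norm_mult using symbol_le[of "Complex u s"] assms \<open>0 \<le> B\<close> by (intro mult_mono) auto
    then show ?thesis
      using \<open>0 \<le> B\<close> decay_const_nonneg by simp
  qed
  then show "AE u in lborel. norm (g u * ml_symbol \<alpha> \<mu> (Complex u s)) \<le> norm (B * decay_const * exp (- \<alpha> * \<bar>u\<bar>))"
    by simp
qed

lemma norm_inverse_line:
  assumes "0 < x" "\<bar>s\<bar> = \<theta>"
  shows "norm (1 / (complex_of_real x - exp (Complex u s))) \<le> 1 / x"
proof -
  have "x \<le> Re (complex_of_real x - exp (Complex u s))"
    using Re_exp_line_neg[OF assms(2), of u] by simp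
  also have "\<dots> \<le> norm (complex_of_real x - exp (Complex u s))"
    by (rule complex_Re_le_cmod)
  finally show ?thesis
    using assms(1) by (auto simp: norm_divide intro!: frac_le)
qed

text \<open>
  Inside the strip \<open>|Im w| \<le> \<theta>\<close> the only pole of \<open>ml_symbol \<alpha> \<mu> w / (x - exp w)\<close> is \<open>w = ln x\<close>, with
  residue \<open>- ml_symbol \<alpha> \<mu> (ln x) / x\<close>. Integrate around the rectangles with vertical sides
  \<open>Re w = \<plusminus>A\<close>; as \<open>A \<rightarrow> \<infinity>\<close> the vertical sides contribute nothing because the symbol decays. The
  assumption that the symbol does not vanish at \<open>ln x\<close> ensures that the pole is genuine.
\<close>

lemma contour_integral_symbol:
  assumes x: "0 < x" and nz: "ml_symbol \<alpha> \<mu> (of_real (ln x)) \<noteq> 0"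
  defines "H \<equiv> \<lambda>w. ml_symbol \<alpha> \<mu> w / (complex_of_real x - exp w)"
  shows "(LINT u|lborel. H (Complex u \<theta>) - H (Complex u (- \<theta>)))
      = 2 * pi * \<i> * (ml_symbol \<alpha> \<mu> (of_real (ln x)) / of_real x)"
proof -
  let ?p = "complex_of_real (ln x)"
  have "\<theta> < min pi (\<bar>Arg \<mu>\<bar> / \<alpha>)"
    using \<theta> \<alpha> by (simp add: field_simps)
  then obtain \<eta> where \<eta>: "\<theta> < \<eta>" "\<eta> < pi" "\<alpha> * \<eta> < \<bar>Arg \<mu>\<bar>"
    using dense[of \<theta> "min pi (\<bar>Arg \<mu>\<bar> / \<alpha>)"] \<alpha> by (auto simp: field_simps)
  \<comment> \<open>An open strip slightly wider than the contour, still free of zeros of the denominators.\<close>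
  define S where "S = {w. - \<eta> < Im w \<and> Im w < \<eta>}"
  have S_eq: "S = {w. Im w > - \<eta>} \<inter> {w. Im w < \<eta>}" by (auto simp: S_def)
  have S: "open S" "convex S"
    unfolding S_eq by (auto intro!: open_Int convex_Int open_halfspace_Im_gt open_halfspace_Im_lt
        convex_halfspace_Im_gt convex_halfspace_Im_lt)
  have symb_hol: "ml_symbol \<alpha> \<mu> holomorphic_on S"
  proof -
    have "exp (of_real \<alpha> * w) - \<mu> \<noteq> 0 \<and> exp w + 1 \<noteq> 0" if "w \<in> S" for w
    proof -
      have "\<bar>Im w\<bar> \<le> \<eta>" using that by (auto simp: S_def)
      then show ?thesis
        using ml_symbol_denominators[OF \<alpha> \<mu> _ \<eta>(2,3), of w] \<eta>(1) \<theta>_pos by auto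
    qed
    then show ?thesis
      unfolding ml_symbol_def by (intro holomorphic_intros) auto
  qed
  have zero: "w = ?p" if "w \<in> S" "exp w = complex_of_real x" for w
  proof -
    have "exp w = exp ?p" using that(2) x by (simp add: exp_of_real)
    then show ?thesis
      using that(1) \<eta>(2) by (intro complex_eqI exp_complex_eqI) (auto simp: S_def)
  qed
  have H_hol: "H holomorphic_on S - {?p}"
    unfolding H_def using zero
    by (intro holomorphic_intros holomorphic_on_subset[OF symb_hol]) auto
  have pS: "?p \<in> S" using \<theta>_pos \<eta> by (auto simp: S_def)
  have res: "residue H ?p = ml_symbol \<alpha> \<mu> ?p / (- of_real x)"
    unfolding H_def
  proof (rule residue_simple_pole_deriv[OF symb_hol _ S(1) convex_connected[OF S(2)] pS _ nz])
    show "(\<lambda>w. complex_of_real x - exp w) holomorphic_on S" by (intro holomorphic_intros)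
    show "((\<lambda>w. complex_of_real x - exp w) has_field_derivative - complex_of_real x) (at ?p)"
      using x by (auto intro!: derivative_eq_intros simp: exp_of_real)
  qed (use x in \<open>auto simp add: exp_of_real\<close>)
  let ?f = "\<lambda>u. H (Complex u \<theta>) - H (Complex u (- \<theta>))"
  have line_int: "integrable lborel (\<lambda>u. H (Complex u s))" if "\<bar>s\<bar> = \<theta>" for s
    using integrable_symbol_line[OF that, of "\<lambda>u. 1 / (complex_of_real x - exp (Complex u s))" "1 / x"]
      norm_inverse_line[OF x that] by (simp add: H_def)
  define V where "V A = contour_integral (linepath (Complex A (- \<theta>)) (Complex A \<theta>)) H
      - contour_integral (linepath (Complex (- A) (- \<theta>)) (Complex (- A) \<theta>)) H" for A
  have seg: "closed_segment (Complex a (- \<theta>)) (Complex a \<theta>) \<subseteq> S - {?p}"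
    if "a \<noteq> ln x" for a
    using that \<eta>(1) \<theta>_pos by (auto simp: closed_segment_same_Re closed_segment_eq_real_ivl S_def)
  have rect: "(LINT u|lborel. indicator {- A..A} u *\<^sub>R ?f u) = 2 * pi * \<i> * (ml_symbol \<alpha> \<mu> ?p / of_real x) + V A"
    if A: "\<bar>ln x\<bar> < A" for A
  proof -
    have "0 < A" using A by linarith
    define a1 a2 a3 a4 where "a1 = Complex (- A) (- \<theta>)" and "a2 = Complex A (- \<theta>)"
      and "a3 = Complex A \<theta>" and "a4 = Complex (- A) \<theta>"
    note a_defs = a1_def a2_def a3_def a4_def
    have box: "?p \<in> box a1 a3"
      using A \<theta>_pos by (auto simp: in_box_complex_iff a_defs)
    have img: "path_image (rectpath a1 a3) \<subseteq> S - {?p}"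
      using A \<theta>_pos \<eta> by (subst path_image_rectpath) (auto simp: a_defs S_def)
    have "contour_integral (rectpath a1 a3) H
        = 2 * pi * \<i> * (\<Sum>p\<in>{?p}. winding_number (rectpath a1 a3) p * residue H p)"
    proof (rule Residue_theorem[OF S(1) convex_connected[OF S(2)] _ H_hol _ _ img])
      show "\<forall>z. z \<notin> S \<longrightarrow> winding_number (rectpath a1 a3) z = 0"
        using img by (auto intro!: winding_number_zero_outside[OF _ S(2)])
    qed auto
    also have "\<dots> = - (2 * pi * \<i> * (ml_symbol \<alpha> \<mu> ?p / of_real x))"
      using winding_number_rectpath[OF box] by (simp add: res)
    finally have 1: "contour_integral (rectpath a1 a3) H = - (2 * pi * \<i> * (ml_symbol \<alpha> \<mu> ?p / of_real x))" .
    have rp: "rectpath a1 a3 = linepath a1 a2 +++ linepath a2 a3 +++ linepath a3 a4 +++ linepath a4 a1"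
      by (simp add: rectpath_def a_defs Let_def)
    have cH: "continuous_on (path_image (rectpath a1 a3)) H"
      using holomorphic_on_imp_continuous_on[OF H_hol] continuous_on_subset img by blast
    have segs: "continuous_on (closed_segment a1 a2) H" "continuous_on (closed_segment a2 a3) H"
      "continuous_on (closed_segment a3 a4) H" "continuous_on (closed_segment a4 a1) H"
      by (rule continuous_on_subset[OF cH]; auto simp: rp path_image_join)+
    have 2: "contour_integral (rectpath a1 a3) H = contour_integral (linepath a1 a2) H
        + contour_integral (linepath a2 a3) H - contour_integral (linepath a4 a3) H - contour_integral (linepath a1 a4) H"
      unfolding rp using segs contour_integral_reverse_linepath[OF segs(3)] contour_integral_reverse_linepath[OF segs(4)]
      by (simp add: contour_integrable_continuous_linepath)
    have cl: "continuous_on {- A..A} (\<lambda>u. H (Complex u s))" if "\<bar>s\<bar> = \<theta>" for s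
    proof (rule continuous_on_compose2[OF cH])
      show "continuous_on {- A..A} (\<lambda>u. Complex u s)"
        unfolding Complex_eq by (intro continuous_intros)
      show "(\<lambda>u. Complex u s) ` {- A..A} \<subseteq> path_image (rectpath a1 a3)"
        using that \<theta>_pos \<open>0 < A\<close> by (subst path_image_rectpath) (auto simp: a_defs)
    qed
    have 3: "contour_integral (linepath a1 a2) H = (LINT u|lborel. indicator {- A..A} u *\<^sub>R H (Complex u (- \<theta>)))"
      "contour_integral (linepath a4 a3) H = (LINT u|lborel. indicator {- A..A} u *\<^sub>R H (Complex u \<theta>))"
      unfolding a_defs using cl[of "- \<theta>"] cl[of \<theta>] \<open>0 < A\<close> \<theta>_pos
      by (simp_all add: contour_integral_horizontal_linepath)
    have "(LINT u|lborel. indicator {- A..A} u *\<^sub>R ?f u)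
        = (LINT u|lborel. indicator {- A..A} u *\<^sub>R H (Complex u \<theta>))
          - (LINT u|lborel. indicator {- A..A} u *\<^sub>R H (Complex u (- \<theta>)))"
      unfolding scaleR_diff_right
      by (rule Bochner_Integration.integral_diff)
        (use line_int \<theta>_pos in \<open>auto intro!: integrable_mult_indicator\<close>)
    also have "\<dots> = - contour_integral (rectpath a1 a3) H + V A"
      unfolding 2 3[symmetric] unfolding V_def a_defs by simp
    finally show ?thesis
      unfolding 1 by simp
  qed
  have V_le: "norm (V A) \<le> 2 * (decay_const * exp (- \<alpha> * A) / (x / 2) * (2 * \<theta>))"
    if A: "\<bar>ln x\<bar> < A" "2 * x \<le> exp A" "2 / x \<le> exp A" for A
  proof -
    have "0 < A" using A by linarith
    have B: "norm (contour_integral (linepath (Complex a (- \<theta>)) (Complex a \<theta>)) H)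
        \<le> decay_const * exp (- \<alpha> * A) / (x / 2) * norm (Complex a \<theta> - Complex a (- \<theta>))"
      if a: "\<bar>a\<bar> = A" for a
    proof (rule contour_integral_bound_linepath)
      have anz: "a \<noteq> ln x" using a A by auto
      show "H contour_integrable_on linepath (Complex a (- \<theta>)) (Complex a \<theta>)"
        using holomorphic_on_imp_continuous_on[OF H_hol] continuous_on_subset seg[OF anz]
        by (intro contour_integrable_continuous_linepath) blast
      show "0 \<le> decay_const * exp (- \<alpha> * A) / (x / 2)"
        using decay_const_nonneg x by simp
      fix w
      assume "w \<in> closed_segment (Complex a (- \<theta>)) (Complex a \<theta>)"
      then have w: "Re w = a" "\<bar>Im w\<bar> \<le> \<theta>"
        using \<theta>_pos by (auto simp: closed_segment_same_Re closed_segment_eq_real_ivl)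
      have "x / 2 \<le> \<bar>x - exp a\<bar>"
      proof (cases "a = A")
        case True
        then show ?thesis using A(2) x by simp
      next
        case False
        then have "exp a = inverse (exp A)" using a by (auto simp: abs_if exp_minus split: if_splits)
        also have "\<dots> \<le> x / 2" using A(3) x by (simp add: field_simps)
        finally show ?thesis using x by simp
      qed
      also have "\<dots> \<le> norm (complex_of_real x - exp w)"
        using norm_triangle_ineq3[of "complex_of_real x" "exp w"] w x by simp
      finally have "x / 2 \<le> norm (complex_of_real x - exp w)" .
      then show "norm (H w) \<le> decay_const * exp (- \<alpha> * A) / (x / 2)"
        unfolding H_def norm_divide using symbol_le[OF w(2)] w a x decay_const_nonneg
        by (intro frac_le) auto
    qed
    have "Complex a \<theta> - Complex a (- \<theta>) = \<i> * of_real (2 * \<theta>)" for a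
      by (simp add: complex_eq_iff)
    then have "norm (Complex a \<theta> - Complex a (- \<theta>)) = 2 * \<theta>" for a
      using \<theta>_pos by (simp add: norm_mult)
    then show ?thesis
      using B[of A] B[of "- A"] \<open>0 < A\<close> norm_triangle_ineq4 unfolding V_def
      by (smt (verit))
  qed
  have V0: "(V \<longlongrightarrow> 0) at_top"
  proof (rule Lim_null_comparison)
    have "\<forall>\<^sub>F A in at_top. \<bar>ln x\<bar> < A" by (rule eventually_gt_at_top)
    moreover have "\<forall>\<^sub>F A in at_top. 2 * x \<le> exp A"
      using exp_at_top by (auto simp: filterlim_at_top)
    moreover have "\<forall>\<^sub>F A in at_top. 2 / x \<le> exp A"
      using exp_at_top by (auto simp: filterlim_at_top)
    ultimately show "\<forall>\<^sub>F A in at_top. norm (V A) \<le> 2 * (decay_const * exp (- \<alpha> * A) / (x / 2) * (2 * \<theta>))"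
      by eventually_elim (rule V_le)
    have "((\<lambda>A. exp (- \<alpha> * A)) \<longlongrightarrow> 0) at_top"
      using \<alpha>(1) by real_asymp
    from tendsto_mult_right_zero[OF this, of "2 * (decay_const / (x / 2) * (2 * \<theta>))"]
    show "((\<lambda>A. 2 * (decay_const * exp (- \<alpha> * A) / (x / 2) * (2 * \<theta>))) \<longlongrightarrow> 0) at_top"
      by (simp add: mult_ac)
  qed
  have f_int: "integrable lborel ?f"
    using line_int \<theta>_pos by (intro Bochner_Integration.integrable_diff) auto
  have "((\<lambda>A. LINT u|lborel. indicator {- A..A} u *\<^sub>R ?f u) \<longlongrightarrow> integral\<^sup>L lborel ?f) at_top"
  proof (rule integral_dominated_convergence_at_top[where w = "\<lambda>u. norm (?f u)"])
    show f_meas: "?f \<in> borel_measurable lborel" using f_int by auto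
    show "(\<lambda>u. indicator {- A..A} u *\<^sub>R ?f u) \<in> borel_measurable lborel" for A
      using f_meas by measurable
    show "integrable lborel (\<lambda>u. norm (?f u))" using f_int by auto
    show "AE u in lborel. ((\<lambda>A. indicator {- A..A} u *\<^sub>R ?f u) \<longlongrightarrow> ?f u) at_top"
    proof (rule AE_I2)
      fix u :: real
      have "\<forall>\<^sub>F A in at_top. \<bar>u\<bar> \<le> A" by (rule eventually_ge_at_top)
      then have "\<forall>\<^sub>F A in at_top. indicator {- A..A} u *\<^sub>R ?f u = ?f u"
        by eventually_elim (auto simp: indicator_def)
      then show "((\<lambda>A. indicator {- A..A} u *\<^sub>R ?f u) \<longlongrightarrow> ?f u) at_top"
        by (rule tendsto_eventually)
    qed
  qed (auto simp: indicator_def)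
  moreover have "((\<lambda>A. LINT u|lborel. indicator {- A..A} u *\<^sub>R ?f u)
      \<longlongrightarrow> 2 * pi * \<i> * (ml_symbol \<alpha> \<mu> ?p / of_real x) + 0) at_top"
  proof (rule Lim_transform_eventually)
    show "((\<lambda>A. 2 * pi * \<i> * (ml_symbol \<alpha> \<mu> ?p / of_real x) + V A)
       \<longlongrightarrow> 2 * pi * \<i> * (ml_symbol \<alpha> \<mu> ?p / of_real x) + 0) at_top"
      by (intro tendsto_intros V0)
    show "\<forall>\<^sub>F A in at_top. 2 * pi * \<i> * (ml_symbol \<alpha> \<mu> ?p / of_real x) + V A
        = (LINT u|lborel. indicator {- A..A} u *\<^sub>R ?f u)"
      using eventually_gt_at_top[of "\<bar>ln x\<bar>"] by eventually_elim (rule rect[symmetric])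
  qed
  ultimately show ?thesis
    using tendsto_unique[OF trivial_limit_at_top_linorder] by fastforce
qed

text \<open>
  With \<open>p = exp w\<close>, the integrands on the upper and on the lower ray are combined; in this
  orientation the integral over \<open>u\<close> runs along the boundary of the sector from
  \<open>exp (- \<i> \<theta>) \<infinity>\<close> to \<open>exp (\<i> \<theta>) \<infinity>\<close>.
\<close>

definition bromwich_integrand :: "real \<Rightarrow> real \<Rightarrow> complex" where
  "bromwich_integrand t u = exp (of_real t * exp (Complex u \<theta>)) * ml_symbol \<alpha> \<mu> (Complex u \<theta>)
      - exp (of_real t * exp (Complex u (- \<theta>))) * ml_symbol \<alpha> \<mu> (Complex u (- \<theta>))"

definition bromwich :: "real \<Rightarrow> complex" where
  "bromwich t = (LINT u|lborel. bromwich_integrand t u) / (2 * pi * \<i>)"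

lemma bromwich_integrand_measurable [measurable]: "(\<lambda>(t, u). bromwich_integrand t u) \<in> borel_measurable (borel \<Otimes>\<^sub>M borel)"
  unfolding bromwich_integrand_def by measurable

lemma bromwich_integrand_section_measurable [measurable]: "bromwich_integrand t \<in> borel_measurable borel"
  unfolding bromwich_integrand_def by measurable

lemma norm_exp_line: "0 \<le> t \<Longrightarrow> \<bar>s\<bar> = \<theta> \<Longrightarrow> norm (exp (of_real t * exp (Complex u s))) \<le> 1"
  using Re_exp_line_neg[of s u] by (simp add: mult_nonneg_nonpos)

lemma norm_bromwich_integrand_le:
  assumes "0 \<le> t"
  shows "norm (bromwich_integrand t u) \<le> 2 * decay_const * exp (- \<alpha> * \<bar>u\<bar>)"
proof -
  have "norm (exp (of_real t * exp (Complex u s)) * ml_symbol \<alpha> \<mu> (Complex u s)) \<le> 1 * (decay_const * exp (- \<alpha> * \<bar>u\<bar>))"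
    if "\<bar>s\<bar> = \<theta>" for s
    unfolding norm_mult using norm_exp_line[OF assms that] symbol_le[of "Complex u s"] that
    by (intro mult_mono) auto
  from this[of \<theta>] this[of "- \<theta>"] show ?thesis
    unfolding bromwich_integrand_def using \<theta>_pos by (intro order_trans[OF norm_triangle_ineq4]) simp
qed

lemma integrable_majorant: "integrable lborel (\<lambda>u. 2 * decay_const * exp (- \<alpha> * \<bar>u\<bar>))"
  by (intro integrable_mult_right integrable_exp_neg_abs \<alpha>)

lemma bromwich_bounded: "\<exists>K. \<forall>t\<ge>0. norm (bromwich t) \<le> K"
proof (intro exI allI impI)
  fix t :: real
  assume "0 \<le> t"
  have "norm (LINT u|lborel. bromwich_integrand t u) \<le> (LINT u|lborel. 2 * decay_const * exp (- \<alpha> * \<bar>u\<bar>))"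
  proof (rule Bochner_Integration.integral_norm_bound_integral)
    show "integrable lborel (bromwich_integrand t)"
      by (rule Bochner_Integration.integrable_bound[OF integrable_majorant])
        (use norm_bromwich_integrand_le[OF \<open>0 \<le> t\<close>] decay_const_nonneg in auto)
  qed (use norm_bromwich_integrand_le[OF \<open>0 \<le> t\<close>] integrable_majorant in auto)
  moreover have "norm (2 * pi * \<i>) = 2 * pi" by (simp add: norm_mult)
  ultimately show "norm (bromwich t) \<le> (LINT u|lborel. 2 * decay_const * exp (- \<alpha> * \<bar>u\<bar>)) / (2 * pi)"
    unfolding bromwich_def norm_divide by (simp only:) (rule divide_right_mono, simp_all)
qed

lemma continuous_on_bromwich: "continuous_on {0..} bromwich"
proof (rule continuous_on_sequentiallyI)
  fix T :: "nat \<Rightarrow> real" and t :: real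
  assume T: "\<forall>n. T n \<in> {0..}" "T \<longlonglongrightarrow> t"
  have "(\<lambda>n. integral\<^sup>L lborel (bromwich_integrand (T n))) \<longlonglongrightarrow> integral\<^sup>L lborel (bromwich_integrand t)"
  proof (rule integral_dominated_convergence[OF _ _ integrable_majorant])
    show "AE u in lborel. (\<lambda>n. bromwich_integrand (T n) u) \<longlonglongrightarrow> bromwich_integrand t u"
      unfolding bromwich_integrand_def using T(2) by (intro AE_I2 tendsto_intros)
  qed (use T norm_bromwich_integrand_le in auto)
  then show "(\<lambda>n. bromwich (T n)) \<longlonglongrightarrow> bromwich t"
    unfolding bromwich_def by (intro tendsto_intros) auto
qed

lemma bromwich_tendsto_0: "(bromwich \<longlongrightarrow> 0) at_top"
proof -
  have "((\<lambda>t. integral\<^sup>L lborel (bromwich_integrand t)) \<longlongrightarrow> integral\<^sup>L lborel (\<lambda>u::real. 0)) at_top"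
  proof (rule integral_dominated_convergence_at_top[where w = "\<lambda>u. 2 * decay_const * exp (- \<alpha> * \<bar>u\<bar>)"])
    show "integrable lborel (\<lambda>u. 2 * decay_const * exp (- \<alpha> * \<bar>u\<bar>))" by (rule integrable_majorant)
    show "\<forall>\<^sub>F t in at_top. AE u in lborel. norm (bromwich_integrand t u) \<le> 2 * decay_const * exp (- \<alpha> * \<bar>u\<bar>)"
      using eventually_ge_at_top[of 0] by eventually_elim (use norm_bromwich_integrand_le in auto)
    have e0: "((\<lambda>t. exp (of_real t * exp (Complex u s))) \<longlongrightarrow> 0) at_top" if "\<bar>s\<bar> = \<theta>" for u s
    proof (rule Lim_null_comparison[OF always_eventually])
      show "((\<lambda>t. exp (t * Re (exp (Complex u s)))) \<longlongrightarrow> 0) at_top"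
        using Re_exp_line_neg[OF that, of u] by real_asymp
    qed simp
    show "AE u in lborel. ((\<lambda>t. bromwich_integrand t u) \<longlongrightarrow> 0) at_top"
    proof (rule AE_I2)
      fix u
      show "((\<lambda>t. bromwich_integrand t u) \<longlongrightarrow> 0) at_top"
        unfolding bromwich_integrand_def
        using tendsto_diff[OF tendsto_mult_left_zero[OF e0[of \<theta> u]] tendsto_mult_left_zero[OF e0[of "- \<theta>" u]]] \<theta>_pos
        by simp
    qed
  qed auto
  then have "((\<lambda>t. integral\<^sup>L lborel (bromwich_integrand t) / (2 * pi * \<i>)) \<longlongrightarrow> 0 / (2 * pi * \<i>)) at_top"
    by (intro tendsto_divide) auto
  then show ?thesis by (simp add: bromwich_def[abs_def])
qed

text \<open>
  Fubini's theorem, together with \<open>\<integral> exp (- x t) exp (t p) dt = 1 / (x - p)\<close>, reduces the Laplace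
  transform to the contour integral of \<open>contour_integral_symbol\<close>.
\<close>

lemma laplace_bromwich:
  assumes x: "0 < x" and nz: "ml_symbol \<alpha> \<mu> (of_real (ln x)) \<noteq> 0"
  shows "has_bochner_integral lborel
     (\<lambda>t. indicator {0..} t *\<^sub>R (exp (- x * t) *\<^sub>R bromwich t)) (ml_symbol \<alpha> \<mu> (of_real (ln x)) / of_real x)"
proof -
  let ?B = "\<lambda>u. 2 * decay_const * exp (- \<alpha> * \<bar>u\<bar>)"
  let ?E = "\<lambda>t. indicator {0..} t * exp (- x * t)"
  let ?F = "\<lambda>t u. ?E t *\<^sub>R bromwich_integrand t u"
  have E_int: "integrable lborel ?E"
    using has_bochner_integral_exp_minus[OF x] by (simp add: has_bochner_integral_iff)
  have prod_int: "integrable (lborel \<Otimes>\<^sub>M lborel) (\<lambda>(t, u). ?E t * ?B u)"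
  proof (rule lborel_pair.Fubini_integrable)
    show "integrable lborel (\<lambda>t. LINT u|lborel. norm (case (t, u) of (t, u) \<Rightarrow> ?E t * ?B u))"
    proof -
      have "(LINT u|lborel. norm (case (t, u) of (t, u) \<Rightarrow> ?E t * ?B u)) = ?E t * integral\<^sup>L lborel ?B" for t
        using decay_const_nonneg by (simp add: abs_mult)
      then show ?thesis
        using integrable_mult_left[OF E_int, of "integral\<^sup>L lborel ?B"] by simp
    qed
    show "AE t in lborel. integrable lborel (\<lambda>u. case (t, u) of (t, u) \<Rightarrow> ?E t * ?B u)"
      using integrable_majorant by (intro AE_I2) (auto simp del: mult_minus_left intro!: integrable_mult_right)
  qed measurable
  have F_int: "integrable (lborel \<Otimes>\<^sub>M lborel) (\<lambda>(t, u). ?F t u)"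
  proof (rule Bochner_Integration.integrable_bound[OF prod_int])
    show "(\<lambda>(t, u). ?F t u) \<in> borel_measurable (lborel \<Otimes>\<^sub>M lborel)"
      by measurable
    have "norm (?F t u) \<le> norm (?E t * ?B u)" for t u
    proof (cases "0 \<le> t")
      case True
      then show ?thesis
        using norm_bromwich_integrand_le[OF True, of u] decay_const_nonneg by simp
    qed simp
    then show "AE p in lborel \<Otimes>\<^sub>M lborel. norm (case p of (t, u) \<Rightarrow> ?F t u) \<le> norm (case p of (t, u) \<Rightarrow> ?E t * ?B u)"
      by (intro AE_I2) (auto simp: case_prod_beta)
  qed
  have lap: "(LINT t|lborel. ?F t u) = ml_symbol \<alpha> \<mu> (Complex u \<theta>) / (of_real x - exp (Complex u \<theta>))
      - ml_symbol \<alpha> \<mu> (Complex u (- \<theta>)) / (of_real x - exp (Complex u (- \<theta>)))" for u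
  proof -
    have h: "has_bochner_integral lborel (\<lambda>t. (indicator {0..} t *\<^sub>R (exp (- x * t) *\<^sub>R exp (of_real t * exp (Complex u s)))) * ml_symbol \<alpha> \<mu> (Complex u s))
      (1 / (of_real x - exp (Complex u s)) * ml_symbol \<alpha> \<mu> (Complex u s))" if "\<bar>s\<bar> = \<theta>" for s
      using Re_exp_line_neg[OF that, of u] x
      by (intro has_bochner_integral_mult_left laplace_exp) auto
    have "?F t u = (indicator {0..} t *\<^sub>R (exp (- x * t) *\<^sub>R exp (of_real t * exp (Complex u \<theta>)))) * ml_symbol \<alpha> \<mu> (Complex u \<theta>)
        - (indicator {0..} t *\<^sub>R (exp (- x * t) *\<^sub>R exp (of_real t * exp (Complex u (- \<theta>))))) * ml_symbol \<alpha> \<mu> (Complex u (- \<theta>))" for t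
      by (simp add: bromwich_integrand_def scaleR_diff_right)
    then show ?thesis
      using has_bochner_integral_diff[OF h[of \<theta>] h[of "- \<theta>"]] \<theta>_pos
      by (simp add: has_bochner_integral_iff)
  qed
  have out: "(LINT u|lborel. ?F t u) = ?E t *\<^sub>R (LINT u|lborel. bromwich_integrand t u)" for t by simp
  have "(LINT t|lborel. ?E t *\<^sub>R (LINT u|lborel. bromwich_integrand t u)) = (LINT u|lborel. LINT t|lborel. ?F t u)"
    using lborel_pair.Fubini_integral[OF F_int] unfolding out by simp
  also have "\<dots> = 2 * pi * \<i> * (ml_symbol \<alpha> \<mu> (of_real (ln x)) / of_real x)"
    unfolding lap by (rule contour_integral_symbol[OF x nz])
  finally have v: "(LINT t|lborel. ?E t *\<^sub>R (LINT u|lborel. bromwich_integrand t u)) = \<dots>" .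
  have i: "integrable lborel (\<lambda>t. ?E t *\<^sub>R (LINT u|lborel. bromwich_integrand t u))"
    using lborel_pair.integrable_fst'[OF F_int] unfolding out by simp
  have eq: "indicator {0..} t *\<^sub>R (exp (- x * t) *\<^sub>R bromwich t) = (?E t *\<^sub>R (LINT u|lborel. bromwich_integrand t u)) / (2 * pi * \<i>)" for t
    by (simp add: bromwich_def scaleR_conv_of_real)
  show ?thesis
    unfolding eq using i v by (simp add: has_bochner_integral_iff)
qed

text \<open>
  The symbol vanishes at \<open>ln x\<close> only if \<open>x\<^sup>\<alpha> = - \<mu> x\<close>, which is excluded for large \<open>x\<close> by comparing
  moduli.
\<close>

lemma ml_symbol_ln_nonzero:
  assumes x: "0 < x" "1 < norm \<mu> * x powr (1 - \<alpha>)"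
  shows "ml_symbol \<alpha> \<mu> (of_real (ln x)) / of_real x
      = of_real (x powr \<alpha> / x) / (of_real (x powr \<alpha>) - \<mu>) - 1 / (of_real x + 1)"
    "ml_symbol \<alpha> \<mu> (of_real (ln x)) \<noteq> 0"
proof -
  have e: "exp (of_real \<alpha> * of_real (ln x)) = complex_of_real (x powr \<alpha>)" "exp (complex_of_real (ln x)) = of_real x"
    using x by (simp_all add: powr_def exp_of_real flip: of_real_mult)
  have d: "complex_of_real (x powr \<alpha>) \<noteq> \<mu>" "complex_of_real x + 1 \<noteq> 0"
    using ml_symbol_denominators[OF \<alpha> \<mu> _ \<theta>(2,3), of "of_real (ln x)"] \<theta>_pos e by auto
  show "ml_symbol \<alpha> \<mu> (of_real (ln x)) / of_real x
      = of_real (x powr \<alpha> / x) / (of_real (x powr \<alpha>) - \<mu>) - 1 / (of_real x + 1)"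
    unfolding ml_symbol_def e using x by (simp add: diff_divide_distrib)
  show "ml_symbol \<alpha> \<mu> (of_real (ln x)) \<noteq> 0"
  proof
    assume "ml_symbol \<alpha> \<mu> (of_real (ln x)) = 0"
    then have "complex_of_real (x powr \<alpha>) = - \<mu> * of_real x"
      unfolding ml_symbol_def e using d by (simp add: field_simps eq_neg_iff_add_eq_0)
    then have "norm (complex_of_real (x powr \<alpha>)) = norm \<mu> * x"
      using x by (simp add: norm_mult)
    then have "x powr \<alpha> = norm \<mu> * x"
      using x by simp
    moreover have "x = x powr (1 - \<alpha>) * x powr \<alpha>"
      using x by (simp flip: powr_add)
    moreover have "1 * x powr \<alpha> < (norm \<mu> * x powr (1 - \<alpha>)) * x powr \<alpha>"
      using x by (intro mult_strict_right_mono) auto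
    ultimately show False by (metis mult.assoc mult_1 less_irrefl)
  qed
qed

text \<open>
  Both sides are continuous, grow at most exponentially and have the same Laplace transform at
  every large \<open>x\<close>.
\<close>

lemma mittag_leffler_eq_bromwich:
  assumes "0 \<le> t"
  shows "mittag_leffler \<alpha> 1 (\<mu> * of_real (t powr \<alpha>)) = of_real (exp (- t)) + bromwich t"
proof -
  let ?e = "\<lambda>t. mittag_leffler \<alpha> 1 (\<mu> * complex_of_real (t powr \<alpha>))"
  \<comment> \<open>Beyond \<open>s\<close> the Mittag-Leffler series is dominated by a geometric series with ratio \<open>1 / 2\<close>, and
    the symbol does not vanish at \<open>ln x\<close>.\<close>
  define s where "s = max 1 (max ((2 * norm \<mu>) powr (1 / \<alpha>)) ((1 / norm \<mu>) powr (1 / (1 - \<alpha>))))"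
  have s0: "0 < s" by (simp add: s_def)
  have s1: "2 * norm \<mu> \<le> x powr \<alpha>" if "s \<le> x" for x
  proof -
    have "((2 * norm \<mu>) powr (1 / \<alpha>)) powr \<alpha> \<le> x powr \<alpha>"
      using that \<alpha> by (intro powr_mono2) (auto simp: s_def)
    then show ?thesis using \<alpha> by (simp add: powr_powr)
  qed
  have s2: "1 < norm \<mu> * x powr (1 - \<alpha>)" if "s < x" for x
  proof -
    have "((1 / norm \<mu>) powr (1 / (1 - \<alpha>))) powr (1 - \<alpha>) < x powr (1 - \<alpha>)"
      using that \<alpha> by (intro powr_less_mono2) (auto simp: s_def)
    then show ?thesis using \<alpha> \<mu> by (simp add: powr_powr field_simps)
  qed
  obtain K where K: "\<And>t. 0 \<le> t \<Longrightarrow> norm (bromwich t) \<le> K"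
    using bromwich_bounded by auto
  have "?e t - of_real (exp (- t)) - bromwich t = 0"
  proof (rule laplace_injective[where C = "3 + K" and s = s])
    show "continuous_on {0..} (\<lambda>t. ?e t - of_real (exp (- t)) - bromwich t)"
      by (intro continuous_intros continuous_mittag_leffler_curve continuous_on_bromwich \<alpha>)
    show "norm (?e t - of_real (exp (- t)) - bromwich t) \<le> (3 + K) * exp (s * t)" if t: "0 \<le> t" for t
    proof -
      have "0 \<le> K" using K[of 0] norm_ge_zero order_trans by blast
      have E: "1 \<le> exp (s * t)" using s0 t by simp
      have "norm (?e t - of_real (exp (- t)) - bromwich t) \<le> norm (?e t) + norm (complex_of_real (exp (- t))) + norm (bromwich t)"
        by (smt (verit) norm_triangle_ineq4)
      also have "\<dots> \<le> 2 * exp (s * t) + 1 * exp (s * t) + K * exp (s * t)"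
      proof (intro add_mono)
        show "norm (?e t) \<le> 2 * exp (s * t)"
          by (rule mittag_leffler_exp_bound[OF \<alpha>(1) s0 s1 t]) simp
        show "norm (complex_of_real (exp (- t))) \<le> 1 * exp (s * t)"
          using E t by (simp add: order_trans[of _ 1])
        show "norm (bromwich t) \<le> K * exp (s * t)"
          using K[OF t] mult_left_mono[OF E \<open>0 \<le> K\<close>] by simp
      qed
      finally show ?thesis by (simp add: algebra_simps)
    qed
    show "has_bochner_integral lborel (\<lambda>t. indicator {0..} t *\<^sub>R (exp (- x * t) *\<^sub>R (?e t - of_real (exp (- t)) - bromwich t))) 0"
      if x: "s < x" for x
    proof -
      have x0: "0 < x" using s0 x by simp
      have "2 * norm \<mu> \<le> x powr \<alpha>" "0 < norm \<mu>" using s1[of x] x \<mu> by auto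
      then have "norm \<mu> < x powr \<alpha>" by linarith
      note L1 = laplace_mittag_leffler[OF \<alpha>(1) x0 this]
      have L2: "has_bochner_integral lborel (\<lambda>t. indicator {0..} t *\<^sub>R (exp (- x * t) *\<^sub>R of_real (exp (- t)))) (1 / (complex_of_real x + 1))"
        using laplace_exp[of "- 1" x] x0 by (simp flip: exp_of_real)
      note L3 = laplace_bromwich[OF x0 ml_symbol_ln_nonzero(2)[OF x0 s2[OF x]]]
      show ?thesis
        using has_bochner_integral_diff[OF has_bochner_integral_diff[OF L1 L2] L3]
        unfolding ml_symbol_ln_nonzero(1)[OF x0 s2[OF x]]
        by (simp add: scaleR_diff_right)
    qed
  qed (rule assms)
  then show ?thesis by (simp add: algebra_simps)
qed

end

text \<open>
  The solution of the test equation decays: both terms of \<open>mittag_leffler_eq_bromwich\<close> tend to \<open>0\<close>.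
\<close>

lemma mittag_leffler_tendsto_0:
  assumes "0 < \<alpha>" "\<alpha> < 1" "\<mu> \<in> stability_sector \<alpha>"
  shows "((\<lambda>t. mittag_leffler \<alpha> 1 (\<mu> * of_real (t powr \<alpha>))) \<longlongrightarrow> 0) at_top"
proof -
  have "pi / 2 < min pi (\<bar>Arg \<mu>\<bar> / \<alpha>)"
    using assms pi_gt_zero by (simp add: stability_sector_def field_simps)
  then obtain \<theta> where "pi / 2 < \<theta>" "\<theta> < min pi (\<bar>Arg \<mu>\<bar> / \<alpha>)"
    using dense by blast
  then interpret sector_contour \<alpha> \<theta> \<mu>
    by unfold_locales (use assms in \<open>auto simp: stability_sector_def field_simps\<close>)
  have "((\<lambda>t. of_real (exp (- t)) + bromwich t) \<longlongrightarrow> of_real 0 + 0) at_top"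
    by (intro tendsto_add tendsto_of_real bromwich_tendsto_0) real_asymp
  then have "((\<lambda>t. of_real (exp (- t)) + bromwich t) \<longlongrightarrow> 0) at_top" by simp
  then show ?thesis
  proof (rule Lim_transform_eventually)
    show "\<forall>\<^sub>F t in at_top. of_real (exp (- t)) + bromwich t = mittag_leffler \<alpha> 1 (\<mu> * of_real (t powr \<alpha>))"
      using eventually_ge_at_top[of 0] by eventually_elim (simp add: mittag_leffler_eq_bromwich)
  qed
qed

section \<open>Riemann-Liouville integrals and variation of constants\<close>

text \<open>
  Euler's Beta integral, rescaled from \<open>[0, 1]\<close> to \<open>[r, t]\<close>. At \<open>r = t\<close> both sides are \<open>0\<close> because
  \<open>0 powr c = 0\<close> for every \<open>c\<close>.
\<close>

lemma has_bochner_integral_beta_convolution: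
  fixes a b r t :: real
  assumes "0 < a" "0 < b" "r \<le> t"
  shows "has_bochner_integral lborel
     (\<lambda>s. indicator {r..t} s * ((t - s) powr (a - 1) * (s - r) powr (b - 1)))
     (Beta a b * (t - r) powr (a + b - 1))"
proof (cases "r = t")
  case True
  then have "(\<lambda>s. indicator {r..t} s * ((t - s) powr (a - 1) * (s - r) powr (b - 1))) = (\<lambda>s. 0)"
    by (auto simp: indicator_def fun_eq_iff)
  then show ?thesis using True by (simp add: has_bochner_integral_iff)
next
  case False
  then have rt: "0 < t - r" using assms by simp
  let ?g = "\<lambda>x. indicator {0..1} x * (x powr (b - 1) * (1 - x) powr (a - 1))"
  let ?h = "\<lambda>s. indicator {r..t} s * ((t - s) powr (a - 1) * (s - r) powr (b - 1))"
  have B: "0 \<le> Beta a b"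
    using assms by (simp add: Beta_def Gamma_real_pos less_imp_le)
  have g: "has_bochner_integral lborel ?g (Beta a b)"
  proof (rule has_bochner_integral_nn_integral)
    show "(\<integral>\<^sup>+ x. ennreal (?g x) \<partial>lborel) = ennreal (Beta a b)"
      using nn_integral_has_integral_lebesgue'[OF _ has_integral_Beta_real[OF assms(2,1)]]
      by (simp add: Beta_commute indicator_mult_ennreal mult.commute)
  qed (use B in auto)
  have arg: "- r / (t - r) + 1 / (t - r) * s = (s - r) / (t - r)" for s
    by (simp add: diff_divide_distrib)
  have eq: "?g (- r / (t - r) + 1 / (t - r) * s) = (1 / (t - r)) powr (a + b - 2) * ?h s" for s
  proof (cases "r \<le> s \<and> s \<le> t")
    case True
    have "1 - (s - r) / (t - r) = (t - s) / (t - r)" using rt by (simp add: field_simps)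
    moreover have "(1 / (t - r)) powr (a + b - 2) = (1 / (t - r)) powr (b - 1) * (1 / (t - r)) powr (a - 1)"
      by (simp add: algebra_simps flip: powr_add)
    moreover have "((s - r) / (t - r)) powr (b - 1) = (s - r) powr (b - 1) * (1 / (t - r)) powr (b - 1)"
      using rt True powr_mult[of "s - r" "1 / (t - r)"] by simp
    moreover have "((t - s) / (t - r)) powr (a - 1) = (t - s) powr (a - 1) * (1 / (t - r)) powr (a - 1)"
      using rt True powr_mult[of "t - s" "1 / (t - r)"] by simp
    ultimately show ?thesis
      using True rt unfolding arg by (simp add: indicator_def)
  next
    case False
    then show ?thesis using rt unfolding arg by (auto simp: indicator_def zero_le_divide_iff)
  qed
  have i: "integrable lborel (\<lambda>s. (1 / (t - r)) powr (a + b - 2) * ?h s)"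
    using g rt lborel_integrable_real_affine[of ?g "1 / (t - r)" "- r / (t - r)"]
    unfolding eq by (simp add: has_bochner_integral_iff)
  have v: "Beta a b = \<bar>1 / (t - r)\<bar> *\<^sub>R (LINT s|lborel. (1 / (t - r)) powr (a + b - 2) * ?h s)"
    using g rt lborel_integral_real_affine[of "1 / (t - r)" ?g "- r / (t - r)"]
    unfolding eq by (simp add: has_bochner_integral_iff)
  have "integrable lborel ?h"
    using i rt by (subst (asm) integrable_mult_left_iff) auto
  moreover have "integral\<^sup>L lborel ?h = Beta a b * (t - r) powr (a + b - 1)"
  proof -
    have "Beta a b = ((1 / (t - r)) powr 1 * (1 / (t - r)) powr (a + b - 2)) * integral\<^sup>L lborel ?h"
      using v rt by simp
    also have "(1 / (t - r)) powr 1 * (1 / (t - r)) powr (a + b - 2) = (1 / (t - r)) powr (a + b - 1)"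
      by (rule trans[OF powr_add[symmetric]]) (rule arg_cong2[where f = "(powr)"], auto)
    also have "\<dots> = 1 / (t - r) powr (a + b - 1)"
      using rt by (simp add: powr_divide)
    finally show ?thesis using rt by simp
  qed
  ultimately show ?thesis by (simp add: has_bochner_integral_iff)
qed

lemma has_bochner_integral_powr_convolution:
  fixes a t :: real
  assumes "0 < a" "0 \<le> t"
  shows "has_bochner_integral lborel (\<lambda>s. indicator {0..t} s * (t - s) powr (a - 1)) (t powr a / a)"
proof (rule has_bochner_integral_cong_AE[THEN iffD1])
  have "Beta a 1 = 1 / a"
  proof -
    have "Gamma a \<noteq> 0" using Gamma_real_pos[OF assms(1)] by linarith
    then show ?thesis using Gamma_real_plus1[OF assms(1)] by (simp add: Beta_def)
  qed
  then show "has_bochner_integral lborel (\<lambda>s. indicator {0..t} s * ((t - s) powr (a - 1) * (s - 0) powr (1 - 1))) (t powr a / a)"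
    using has_bochner_integral_beta_convolution[of a 1 0 t] assms by simp
  show "AE s in lborel. indicator {0..t} s * ((t - s) powr (a - 1) * (s - 0) powr (1 - 1)) = indicator {0..t} s * (t - s) powr (a - 1)"
    using AE_lborel_singleton[of 0] by eventually_elim simp
qed auto

definition riemann_liouville :: "real \<Rightarrow> (real \<Rightarrow> complex) \<Rightarrow> real \<Rightarrow> complex" where
  "riemann_liouville a h t = (1 / Gamma a) *\<^sub>R (LINT s:{0..t}|lborel. (t - s) powr (a - 1) *\<^sub>R h s)"

lemma continuous_indicator_measurable:
  fixes h :: "real \<Rightarrow> complex"
  assumes "continuous_on {0..} h"
  shows "(\<lambda>s. indicator {0..} s *\<^sub>R h s) \<in> borel_measurable borel"
  using borel_measurable_continuous_on_indicator[OF _ assms] by simp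

lemma continuous_bounded_Icc:
  fixes h :: "real \<Rightarrow> complex"
  assumes "continuous_on {0..} h"
  obtains B where "0 \<le> B" "\<And>s. 0 \<le> s \<Longrightarrow> s \<le> t \<Longrightarrow> norm (h s) \<le> B"
proof -
  have "compact (h ` {0..t})"
    using assms by (intro compact_continuous_image continuous_on_subset[OF assms]) auto
  then obtain B where "\<forall>x\<in>h ` {0..t}. norm x \<le> B"
    using compact_imp_bounded bounded_iff by metis
  then show ?thesis by (intro that[of "max 0 B"]) (auto simp: le_max_iff_disj)
qed

lemma integrable_riemann_liouville:
  fixes h :: "real \<Rightarrow> complex"
  assumes "0 < a" "0 \<le> t" and h: "continuous_on {0..} h"
  shows "set_integrable lborel {0..t} (\<lambda>s. (t - s) powr (a - 1) *\<^sub>R h s)"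
proof -
  obtain B where B: "0 \<le> B" "\<And>s. 0 \<le> s \<Longrightarrow> s \<le> t \<Longrightarrow> norm (h s) \<le> B"
    using continuous_bounded_Icc[OF h] by metis
  show ?thesis
    unfolding set_integrable_def
  proof (rule Bochner_Integration.integrable_bound)
  show "integrable lborel (\<lambda>s. (indicator {0..t} s * (t - s) powr (a - 1)) * B)"
    using has_bochner_integral_powr_convolution[OF assms(1,2)]
    by (intro integrable_mult_left) (simp add: has_bochner_integral_iff)
  have "(\<lambda>s. indicator {0..t} s *\<^sub>R (t - s) powr (a - 1) *\<^sub>R (indicator {0..} s *\<^sub>R h s)) \<in> borel_measurable lborel"
    using continuous_indicator_measurable[OF h] by measurable
  also have "(\<lambda>s. indicator {0..t} s *\<^sub>R (t - s) powr (a - 1) *\<^sub>R (indicator {0..} s *\<^sub>R h s)) = (\<lambda>s. indicator {0..t} s *\<^sub>R (t - s) powr (a - 1) *\<^sub>R h s)"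
    by (auto simp: indicator_def fun_eq_iff)
  finally show "\<dots> \<in> borel_measurable lborel" .
  show "AE s in lborel. norm (indicator {0..t} s *\<^sub>R (t - s) powr (a - 1) *\<^sub>R h s) \<le> norm ((indicator {0..t} s * (t - s) powr (a - 1)) * B)"
    using B by (intro AE_I2) (auto simp: indicator_def abs_mult intro!: mult_left_mono)
  qed
qed

text \<open>
  The bound for the integral of the norm controls the sum over the orders \<open>a = \<alpha> (j + 1)\<close> when
  summation and integration are interchanged; the bound for the norm of the integral makes the
  remainder of the iteration vanish.
\<close>

lemma norm_riemann_liouville_le:
  fixes h :: "real \<Rightarrow> complex"
  assumes "0 < a" "0 \<le> t" and h: "continuous_on {0..} h" and B: "\<And>s. 0 \<le> s \<Longrightarrow> s \<le> t \<Longrightarrow> norm (h s) \<le> B"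
  shows "(1 / Gamma a) * (LINT s|lborel. norm (indicator {0..t} s *\<^sub>R (t - s) powr (a - 1) *\<^sub>R h s)) \<le> t powr a / Gamma (a + 1) * B"
    and "norm (riemann_liouville a h t) \<le> t powr a / Gamma (a + 1) * B"
proof -
  have G: "0 < Gamma a" "Gamma (a + 1) = a * Gamma a"
    using assms by (auto simp: Gamma_real_pos Gamma_real_plus1)
  note i = integrable_riemann_liouville[OF assms(1-3), unfolded set_integrable_def]
  note k = has_bochner_integral_powr_convolution[OF assms(1,2)]
  have "(LINT s|lborel. norm (indicator {0..t} s *\<^sub>R (t - s) powr (a - 1) *\<^sub>R h s))
      \<le> (LINT s|lborel. (indicator {0..t} s * (t - s) powr (a - 1)) * B)"
    using k integrable_norm[OF i] by (intro integral_mono integrable_mult_left)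
      (auto simp: indicator_def has_bochner_integral_iff intro!: mult_left_mono B)
  also have "\<dots> = t powr a / a * B"
    using k by (simp add: has_bochner_integral_iff)
  finally have "(1 / Gamma a) * (LINT s|lborel. norm (indicator {0..t} s *\<^sub>R (t - s) powr (a - 1) *\<^sub>R h s)) \<le> (1 / Gamma a) * (t powr a / a * B)"
    using G by (intro mult_left_mono) auto
  then show 1: "(1 / Gamma a) * (LINT s|lborel. norm (indicator {0..t} s *\<^sub>R (t - s) powr (a - 1) *\<^sub>R h s)) \<le> t powr a / Gamma (a + 1) * B"
    using G by (simp add: mult.commute)
  have "norm (riemann_liouville a h t) \<le> (1 / Gamma a) * (LINT s|lborel. norm (indicator {0..t} s *\<^sub>R (t - s) powr (a - 1) *\<^sub>R h s))"
  proof -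
    have "norm (LINT s|lborel. indicator {0..t} s *\<^sub>R (t - s) powr (a - 1) *\<^sub>R h s)
        \<le> (LINT s|lborel. norm (indicator {0..t} s *\<^sub>R (t - s) powr (a - 1) *\<^sub>R h s))"
      by (rule Bochner_Integration.integral_norm_bound)
    from mult_left_mono[OF this, of "1 / Gamma a"] show ?thesis
      using G by (simp add: riemann_liouville_def set_lebesgue_integral_def)
  qed
  then show "norm (riemann_liouville a h t) \<le> t powr a / Gamma (a + 1) * B"
    using 1 by linarith
qed

lemma riemann_liouville_const:
  assumes "0 < a" "0 \<le> t"
  shows "riemann_liouville a (\<lambda>_. c) t = (t powr a / Gamma (a + 1)) *\<^sub>R c"
proof -
  note Gamma_real_plus1[OF assms(1)]
  moreover
  have "has_bochner_integral lborel (\<lambda>s. (indicator {0..t} s * (t - s) powr (a - 1)) *\<^sub>R c) ((t powr a / a) *\<^sub>R c)"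
    by (rule has_bochner_integral_scaleR_left) (rule has_bochner_integral_powr_convolution[OF assms])
  then have "(LINT s:{0..t}|lborel. (t - s) powr (a - 1) *\<^sub>R c) = (t powr a / a) *\<^sub>R c"
    unfolding set_lebesgue_integral_def by (simp add: has_bochner_integral_iff)
  ultimately show ?thesis by (simp add: riemann_liouville_def mult.commute)
qed

lemma riemann_liouville_add:
  fixes g h :: "real \<Rightarrow> complex"
  assumes "0 < a" "0 \<le> t" "continuous_on {0..} g" "continuous_on {0..} h"
  shows "riemann_liouville a (\<lambda>s. g s + h s) t = riemann_liouville a g t + riemann_liouville a h t"
  using set_integral_add(2)[OF integrable_riemann_liouville[OF assms(1-3)] integrable_riemann_liouville[OF assms(1,2,4)]]
  by (simp add: riemann_liouville_def scaleR_add_right)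

lemma riemann_liouville_mult:
  "riemann_liouville a (\<lambda>s. c * h s) t = c * riemann_liouville a h t"
proof -
  have "(LINT s:{0..t}|lborel. (t - s) powr (a - 1) *\<^sub>R (c * h s)) = (LINT s|lborel. c * (indicator {0..t} s *\<^sub>R (t - s) powr (a - 1) *\<^sub>R h s))"
    by (simp add: set_lebesgue_integral_def)
  also have "\<dots> = c * (LINT s:{0..t}|lborel. (t - s) powr (a - 1) *\<^sub>R h s)"
    unfolding set_lebesgue_integral_def by (rule integral_mult_right_zero)
  finally show ?thesis by (simp add: riemann_liouville_def)
qed

lemma riemann_liouville_cong:
  assumes "\<And>s. 0 \<le> s \<Longrightarrow> s \<le> t \<Longrightarrow> g s = h s"
  shows "riemann_liouville a g t = riemann_liouville a h t"
  using assms by (auto simp: riemann_liouville_def intro!: set_lebesgue_integral_cong)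

text \<open>
  Interchange the order of integration over the triangle \<open>0 \<le> r \<le> s \<le> t\<close>; the inner integral of
  the two power kernels is the Beta integral.
\<close>

lemma riemann_liouville_semigroup:
  fixes h :: "real \<Rightarrow> complex"
  assumes ab: "0 < a" "0 < b" and t: "0 \<le> t" and h: "continuous_on {0..} h"
  shows "riemann_liouville a (riemann_liouville b h) t = riemann_liouville (a + b) h t"
proof -
  have G: "0 < Gamma a" "0 < Gamma b" "0 < Gamma (a + b)"
    using ab by (auto simp: Gamma_real_pos)
  define g where "g s r = (if 0 \<le> r \<and> r \<le> s \<and> s \<le> t then (t - s) powr (a - 1) * (s - r) powr (b - 1) else 0)" for s r
  define k where "k r = indicator {0..} r *\<^sub>R h r" for r
  have k_meas [measurable]: "k \<in> borel_measurable borel"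
    using continuous_indicator_measurable[OF h] by (simp add: k_def[abs_def])
  have g_meas [measurable]: "(\<lambda>(s, r). g s r) \<in> borel_measurable (borel \<Otimes>\<^sub>M borel)"
    unfolding g_def by measurable
  obtain B where B: "0 \<le> B" "\<And>s. 0 \<le> s \<Longrightarrow> s \<le> t \<Longrightarrow> norm (h s) \<le> B"
    using continuous_bounded_Icc[OF h] by metis
  have g0: "0 \<le> g s r" for s r by (simp add: g_def)
  have g1: "g s r = (indicator {0..t} s * (t - s) powr (a - 1)) * (indicator {0..s} r * (s - r) powr (b - 1))" for s r
    by (auto simp: g_def indicator_def)
  have inner: "has_bochner_integral lborel (g s) ((indicator {0..t} s * (t - s) powr (a - 1)) * (s powr b / b))" for s
  proof (cases "0 \<le> s")
    case True
    show ?thesis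
      unfolding g1[abs_def]
      by (rule has_bochner_integral_mult_right) (use has_bochner_integral_powr_convolution[OF ab(2) True] in simp)
  next
    case False
    then have "g s = (\<lambda>_. 0)" by (auto simp: g_def fun_eq_iff)
    then show ?thesis using False by (simp add: has_bochner_integral_iff)
  qed
  have g_int: "integrable (lborel \<Otimes>\<^sub>M lborel) (\<lambda>(s, r). g s r)"
  proof (rule lborel_pair.Fubini_integrable)
    show "AE s in lborel. integrable lborel (\<lambda>r. case (s, r) of (s, r) \<Rightarrow> g s r)"
      using inner by (auto simp: has_bochner_integral_iff)
    have "integrable lborel (\<lambda>s. indicator {0..t} s * ((t - s) powr (a - 1) * (s - 0) powr (b + 1 - 1)) / b)"
      using has_bochner_integral_beta_convolution[of a "b + 1" 0 t] ab t
      by (intro integrable_divide) (simp add: has_bochner_integral_iff)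
    moreover have "(LINT r|lborel. norm (case (s, r) of (s, r) \<Rightarrow> g s r)) = indicator {0..t} s * ((t - s) powr (a - 1) * (s - 0) powr (b + 1 - 1)) / b" for s
      using inner[of s] g0 by (simp add: has_bochner_integral_iff)
    ultimately show "integrable lborel (\<lambda>s. LINT r|lborel. norm (case (s, r) of (s, r) \<Rightarrow> g s r))"
      by simp
  qed measurable
  have F_int: "integrable (lborel \<Otimes>\<^sub>M lborel) (\<lambda>(s, r). g s r *\<^sub>R k r)"
  proof (rule Bochner_Integration.integrable_bound)
    show "integrable (lborel \<Otimes>\<^sub>M lborel) (\<lambda>p. B * (case p of (s, r) \<Rightarrow> g s r))"
      using g_int by (intro integrable_mult_right) simp
    show "(\<lambda>(s, r). g s r *\<^sub>R k r) \<in> borel_measurable (lborel \<Otimes>\<^sub>M lborel)"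
      by measurable
    have "norm (g s r *\<^sub>R k r) \<le> norm (B * g s r)" for s r
    proof (cases "0 \<le> r \<and> r \<le> t")
      case True
      then show ?thesis
        using mult_left_mono[OF B(2)[of r] g0[of s r]] B(1) g0[of s r]
        by (simp add: k_def abs_mult mult.commute)
    qed (auto simp: g_def)
    then show "AE p in lborel \<Otimes>\<^sub>M lborel. norm (case p of (s, r) \<Rightarrow> g s r *\<^sub>R k r) \<le> norm (B * (case p of (s, r) \<Rightarrow> g s r))"
      by (intro AE_I2) (auto simp: case_prod_beta)
  qed
  have 1: "(LINT r|lborel. g s r *\<^sub>R k r) = Gamma b *\<^sub>R (indicator {0..t} s *\<^sub>R ((t - s) powr (a - 1) *\<^sub>R riemann_liouville b h s))" for s
  proof -
    have "g s r *\<^sub>R k r = (indicator {0..t} s * (t - s) powr (a - 1)) *\<^sub>R (indicator {0..s} r *\<^sub>R (s - r) powr (b - 1) *\<^sub>R h r)" for r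
      by (auto simp: g_def k_def indicator_def)
    then have "(LINT r|lborel. g s r *\<^sub>R k r) = (indicator {0..t} s * (t - s) powr (a - 1)) *\<^sub>R
        (LINT r|lborel. indicator {0..s} r *\<^sub>R (s - r) powr (b - 1) *\<^sub>R h r)"
      by (simp only: integral_scaleR_right)
    then show ?thesis
      using G by (simp add: riemann_liouville_def set_lebesgue_integral_def)
  qed
  have 2: "(LINT s|lborel. g s r *\<^sub>R k r) = Beta a b *\<^sub>R (indicator {0..t} r *\<^sub>R ((t - r) powr (a + b - 1) *\<^sub>R h r))" for r
  proof (cases "0 \<le> r \<and> r \<le> t")
    case True
    have "g s r *\<^sub>R k r = (indicator {r..t} s * ((t - s) powr (a - 1) * (s - r) powr (b - 1))) *\<^sub>R h r" for s
      using True by (auto simp: g_def k_def indicator_def)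
    then show ?thesis
      using has_bochner_integral_beta_convolution[of a b r t] ab True
      by (simp add: has_bochner_integral_iff)
  next
    case False
    then have "g s r = 0" for s by (auto simp: g_def)
    then show ?thesis using False by (auto simp: indicator_def)
  qed
  have "riemann_liouville a (riemann_liouville b h) t
      = (1 / Gamma a) *\<^sub>R (1 / Gamma b) *\<^sub>R (LINT s|lborel. LINT r|lborel. g s r *\<^sub>R k r)"
    unfolding 1 integral_scaleR_right using G by (simp add: riemann_liouville_def[of a] set_lebesgue_integral_def)
  also have "(LINT s|lborel. LINT r|lborel. g s r *\<^sub>R k r) = (LINT r|lborel. LINT s|lborel. g s r *\<^sub>R k r)"
    by (rule lborel_pair.Fubini_integral[OF F_int, symmetric])
  also have "\<dots> = (Beta a b * Gamma (a + b)) *\<^sub>R riemann_liouville (a + b) h t"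
    unfolding 2 integral_scaleR_right using G by (simp add: riemann_liouville_def set_lebesgue_integral_def)
  finally show ?thesis using G by (simp add: Beta_def)
qed

lemma powr_mult_Suc:
  fixes t a :: real
  assumes "0 \<le> t"
  shows "t powr (a * real (Suc n)) = (t powr a) ^ Suc n"
proof (cases "t = 0")
  case False
  then show ?thesis
    using assms powr_realpow[of "t powr a" "Suc n"] by (simp only: powr_powr) simp
qed simp

text \<open>
  Substitute the equation for \<open>y\<close> into its own last term. By the semigroup law the fractional
  integrals add up their orders, and their values at the constant \<open>y\<^sub>0\<close> are the terms of the
  Mittag-Leffler series.
\<close>

lemma volterra_iteration:
  fixes y F :: "real \<Rightarrow> complex"
  assumes \<alpha>: "0 < \<alpha>" and y: "continuous_on {0..} y" and F: "continuous_on {0..} F"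
    and eq: "\<And>t. 0 \<le> t \<Longrightarrow> y t = y0 + riemann_liouville \<alpha> (\<lambda>s. \<mu> * y s + F s) t"
    and t: "0 \<le> t"
  shows "y t = (\<Sum>j<Suc n. (\<mu> * of_real (t powr \<alpha>)) ^ j / of_real (Gamma (\<alpha> * real j + 1))) * y0
      + (\<Sum>j<Suc n. \<mu> ^ j * riemann_liouville (\<alpha> * real (Suc j)) F t)
      + \<mu> ^ Suc n * riemann_liouville (\<alpha> * real (Suc n)) y t"
proof (induction n)
  case 0
  have "riemann_liouville \<alpha> (\<lambda>s. \<mu> * y s + F s) t = \<mu> * riemann_liouville \<alpha> y t + riemann_liouville \<alpha> F t"
    using riemann_liouville_add[OF \<alpha> t _ F, of "\<lambda>s. \<mu> * y s"] y by (simp add: riemann_liouville_mult continuous_intros)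
  then show ?case using eq[OF t] by simp
next
  case (Suc n)
  let ?a = "\<alpha> * real (Suc n)"
  let ?u = "\<lambda>s. \<mu> * y s + F s"
  have a: "0 < ?a" using \<alpha> by simp
  have u: "continuous_on {0..} ?u" by (intro continuous_intros y F)
  have w: "continuous_on {0..} (riemann_liouville \<alpha> ?u)"
  proof (rule continuous_on_eq)
    show "continuous_on {0..} (\<lambda>s. y s - y0)" by (intro continuous_intros y)
  qed (use eq in auto)
  have "riemann_liouville ?a y t = riemann_liouville ?a (\<lambda>s. y0 + riemann_liouville \<alpha> ?u s) t"
    by (rule riemann_liouville_cong) (use eq in auto)
  also have "\<dots> = riemann_liouville ?a (\<lambda>_. y0) t + riemann_liouville ?a (riemann_liouville \<alpha> ?u) t"
    by (rule riemann_liouville_add[OF a t continuous_on_const w])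
  also have "riemann_liouville ?a (riemann_liouville \<alpha> ?u) t = riemann_liouville (?a + \<alpha>) ?u t"
    by (rule riemann_liouville_semigroup[OF a \<alpha> t u])
  also have "?a + \<alpha> = \<alpha> * real (Suc (Suc n))" by (simp add: algebra_simps)
  also have "riemann_liouville \<dots> ?u t = \<mu> * riemann_liouville (\<alpha> * real (Suc (Suc n))) y t + riemann_liouville (\<alpha> * real (Suc (Suc n))) F t"
    using riemann_liouville_add[of "\<alpha> * real (Suc (Suc n))" t "\<lambda>s. \<mu> * y s" F] \<alpha> t y F
    by (simp add: riemann_liouville_mult continuous_intros)
  also have "riemann_liouville ?a (\<lambda>_. y0) t = of_real (t powr \<alpha>) ^ Suc n / of_real (Gamma (\<alpha> * real (Suc n) + 1)) * y0"
  proof -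
    have "t powr ?a = (t powr \<alpha>) ^ Suc n"
      using t by (rule powr_mult_Suc)
    then show ?thesis
      unfolding riemann_liouville_const[OF a t] by (simp add: scaleR_conv_of_real)
  qed
  finally have *: "riemann_liouville ?a y t = of_real (t powr \<alpha>) ^ Suc n / of_real (Gamma (\<alpha> * real (Suc n) + 1)) * y0
      + (\<mu> * riemann_liouville (\<alpha> * real (Suc (Suc n))) y t + riemann_liouville (\<alpha> * real (Suc (Suc n))) F t)" .
  show ?case
    unfolding Suc.IH * sum.lessThan_Suc[of _ "Suc n"] power_mult_distrib power_Suc[of \<mu> "Suc n"]
    by (simp only: distrib_left distrib_right) (simp add: mult_ac)
qed

text \<open>
  The resolvent of the Volterra kernel \<open>\<mu> s\<^sup>\<alpha>\<^sup>-\<^sup>1 / \<Gamma>(\<alpha>)\<close>, up to the factor \<open>\<mu>\<close>; the integrand of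
  \<open>\<rho>\<close> is its modulus.
\<close>

definition resolvent :: "real \<Rightarrow> complex \<Rightarrow> real \<Rightarrow> complex" where
  "resolvent \<alpha> \<mu> s = s powr (\<alpha> - 1) *\<^sub>R mittag_leffler \<alpha> \<alpha> (\<mu> * of_real (s powr \<alpha>))"

text \<open>
  Let the number of iterations tend to infinity: the remainder is bounded by a multiple of a term of a
  convergent Mittag-Leffler series, and the sum of the fractional integrals of \<open>F\<close> may be taken under the
  integral sign.
\<close>

lemma variation_of_constants:
  fixes y F :: "real \<Rightarrow> complex"
  assumes \<alpha>: "0 < \<alpha>" and y: "continuous_on {0..} y" and F: "continuous_on {0..} F"
    and eq: "\<And>t. 0 \<le> t \<Longrightarrow> y t = y0 + riemann_liouville \<alpha> (\<lambda>s. \<mu> * y s + F s) t"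
    and t: "0 \<le> t"
  shows "integrable lborel (\<lambda>s. indicator {0..t} s *\<^sub>R (resolvent \<alpha> \<mu> (t - s) * F s))" (is ?int)
    and "y t = mittag_leffler \<alpha> 1 (\<mu> * of_real (t powr \<alpha>)) * y0
      + (LINT s|lborel. indicator {0..t} s *\<^sub>R (resolvent \<alpha> \<mu> (t - s) * F s))" (is ?val)
proof -
  obtain By where By: "0 \<le> By" "\<And>s. 0 \<le> s \<Longrightarrow> s \<le> t \<Longrightarrow> norm (y s) \<le> By"
    using continuous_bounded_Icc[OF y] by metis
  obtain B where B: "0 \<le> B" "\<And>s. 0 \<le> s \<Longrightarrow> s \<le> t \<Longrightarrow> norm (F s) \<le> B"
    using continuous_bounded_Icc[OF F] by metis
  have G: "0 < Gamma (\<alpha> * real (Suc j))" for j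
    using \<alpha> by (intro Gamma_real_pos) simp
  have a: "0 < \<alpha> * real (Suc j)" for j using \<alpha> by simp
  define r where "r = norm \<mu> * t powr \<alpha>"
  have r: "0 \<le> r" by (simp add: r_def)
  have summ: "summable (\<lambda>j. r ^ j / Gamma (\<alpha> * real j + (\<alpha> + 1)))"
    using summable_mittag_leffler_norm[of \<alpha> "\<alpha> + 1" r] \<alpha> r by simp
  have pw: "t powr (\<alpha> * real (Suc j)) = (t powr \<alpha>) ^ Suc j" for j
    using t by (rule powr_mult_Suc)
  have bnd: "norm \<mu> ^ j * (t powr (\<alpha> * real (Suc j)) / Gamma (\<alpha> * real (Suc j) + 1) * C)
      = (t powr \<alpha> * C) * (r ^ j / Gamma (\<alpha> * real j + (\<alpha> + 1)))" for j C
    unfolding pw by (simp add: r_def power_mult_distrib algebra_simps)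
  define c where "c j = \<mu> ^ j / of_real (Gamma (\<alpha> * real (Suc j)))" for j
  define f where "f j s = c j * (indicator {0..t} s *\<^sub>R (t - s) powr (\<alpha> * real (Suc j) - 1) *\<^sub>R F s)" for j s
  have f_int: "integrable lborel (f j)" for j
    unfolding f_def using integrable_riemann_liouville[OF a t F]
    by (intro integrable_mult_right) (simp add: set_integrable_def)
  have f_val: "integral\<^sup>L lborel (f j) = \<mu> ^ j * riemann_liouville (\<alpha> * real (Suc j)) F t" for j
  proof -
    have c: "c j * X = \<mu> ^ j * ((1 / Gamma (\<alpha> * real (Suc j))) *\<^sub>R X)" for X
      by (simp add: c_def scaleR_conv_of_real)
    then show ?thesis
      unfolding f_def riemann_liouville_def set_lebesgue_integral_def
      by (subst integral_mult_right_zero) (rule c)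
  qed
  have f_eq: "f j s = (indicator {0..t} s *\<^sub>R (t - s) powr (\<alpha> - 1) *\<^sub>R F s) *
      ((\<mu> * of_real ((t - s) powr \<alpha>)) ^ j / of_real (Gamma (\<alpha> * real j + \<alpha>)))" for j s
  proof (cases "0 \<le> s \<and> s < t")
    case True
    have "(t - s) powr (\<alpha> * real (Suc j) - 1) = (t - s) powr ((\<alpha> - 1) + \<alpha> * real j)"
      by (simp add: algebra_simps)
    also have "\<dots> = (t - s) powr (\<alpha> - 1) * ((t - s) powr \<alpha>) ^ j"
      using True by (simp add: powr_add powr_realpow flip: powr_powr)
    finally show ?thesis
      by (simp add: f_def c_def scaleR_conv_of_real power_mult_distrib algebra_simps)
  next
    case False
    then show ?thesis by (cases "s = t") (auto simp: f_def indicator_def)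
  qed
  have 1: "AE s in lborel. summable (\<lambda>j. norm (f j s))"
    unfolding f_eq norm_mult[of "indicator {0..t} _ *\<^sub>R _"]
    by (intro AE_I2 summable_mult summable_mittag_leffler \<alpha>)
  have 2: "summable (\<lambda>j. LINT s|lborel. norm (f j s))"
  proof (rule summable_comparison_test'[where N = 0])
    show "summable (\<lambda>j. (t powr \<alpha> * B) * (r ^ j / Gamma (\<alpha> * real j + (\<alpha> + 1))))"
      by (rule summable_mult[OF summ])
    fix j
    have "(LINT s|lborel. norm (f j s)) = norm \<mu> ^ j * (1 / Gamma (\<alpha> * real (Suc j)) *
        (LINT s|lborel. norm (indicator {0..t} s *\<^sub>R (t - s) powr (\<alpha> * real (Suc j) - 1) *\<^sub>R F s)))"
    proof -
      have "norm (c j) = norm \<mu> ^ j / Gamma (\<alpha> * real (Suc j))"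
        using G[of j] by (simp add: c_def norm_divide norm_power)
      then show ?thesis
        unfolding f_def norm_mult integral_mult_right_zero by simp
    qed
    also have "\<dots> \<le> norm \<mu> ^ j * (t powr (\<alpha> * real (Suc j)) / Gamma (\<alpha> * real (Suc j) + 1) * B)"
      using norm_riemann_liouville_le(1)[OF a t F B(2)] by (intro mult_left_mono) auto
    finally show "norm (LINT s|lborel. norm (f j s)) \<le> (t powr \<alpha> * B) * (r ^ j / Gamma (\<alpha> * real j + (\<alpha> + 1)))"
      unfolding bnd by simp
  qed
  have sum_f: "(\<Sum>j. f j s) = indicator {0..t} s *\<^sub>R (resolvent \<alpha> \<mu> (t - s) * F s)" for s
  proof -
    have "(\<Sum>j. f j s) = (indicator {0..t} s *\<^sub>R (t - s) powr (\<alpha> - 1) *\<^sub>R F s) * mittag_leffler \<alpha> \<alpha> (\<mu> * of_real ((t - s) powr \<alpha>))"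
      unfolding f_eq mittag_leffler_def
      by (rule suminf_mult[OF summable_norm_cancel[OF summable_mittag_leffler[OF \<alpha> \<alpha>]]])
    then show ?thesis by (simp add: resolvent_def mult_ac)
  qed
  show ?int
    using integrable_suminf[OF f_int 1 2] by (simp add: sum_f)
  have "(\<lambda>j. \<mu> ^ j * riemann_liouville (\<alpha> * real (Suc j)) F t) sums
      (LINT s|lborel. indicator {0..t} s *\<^sub>R (resolvent \<alpha> \<mu> (t - s) * F s))"
    using sums_integral[OF f_int 1 2] by (simp only: sum_f f_val)
  then have L2: "(\<lambda>n. \<Sum>j<Suc n. \<mu> ^ j * riemann_liouville (\<alpha> * real (Suc j)) F t) \<longlonglongrightarrow>
      (LINT s|lborel. indicator {0..t} s *\<^sub>R (resolvent \<alpha> \<mu> (t - s) * F s))"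
    unfolding sums_def by (rule LIMSEQ_Suc)
  have "(\<lambda>j. (\<mu> * of_real (t powr \<alpha>)) ^ j / of_real (Gamma (\<alpha> * real j + 1))) sums mittag_leffler \<alpha> 1 (\<mu> * of_real (t powr \<alpha>))"
    unfolding mittag_leffler_def
    by (intro summable_sums summable_norm_cancel[OF summable_mittag_leffler] \<alpha>) simp
  then have L1: "(\<lambda>n. (\<Sum>j<Suc n. (\<mu> * of_real (t powr \<alpha>)) ^ j / of_real (Gamma (\<alpha> * real j + 1)))) \<longlonglongrightarrow> mittag_leffler \<alpha> 1 (\<mu> * of_real (t powr \<alpha>))"
    unfolding sums_def by (rule LIMSEQ_Suc)
  have "(\<lambda>j. \<mu> ^ j * riemann_liouville (\<alpha> * real (Suc j)) y t) \<longlonglongrightarrow> 0"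
  proof (rule Lim_null_comparison[OF always_eventually])
    show "\<forall>j. norm (\<mu> ^ j * riemann_liouville (\<alpha> * real (Suc j)) y t) \<le> (t powr \<alpha> * By) * (r ^ j / Gamma (\<alpha> * real j + (\<alpha> + 1)))"
    proof
      fix j
      have "norm (\<mu> ^ j * riemann_liouville (\<alpha> * real (Suc j)) y t) \<le> norm \<mu> ^ j * (t powr (\<alpha> * real (Suc j)) / Gamma (\<alpha> * real (Suc j) + 1) * By)"
        unfolding norm_mult norm_power using norm_riemann_liouville_le(2)[OF a t y By(2)] by (intro mult_left_mono) auto
      then show "norm (\<mu> ^ j * riemann_liouville (\<alpha> * real (Suc j)) y t) \<le> (t powr \<alpha> * By) * (r ^ j / Gamma (\<alpha> * real j + (\<alpha> + 1)))"
        unfolding bnd .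
    qed
    show "(\<lambda>j. (t powr \<alpha> * By) * (r ^ j / Gamma (\<alpha> * real j + (\<alpha> + 1)))) \<longlonglongrightarrow> 0"
      by (intro tendsto_mult_right_zero summable_LIMSEQ_zero summ)
  qed
  from tendsto_mult_right_zero[OF this, of \<mu>]
  have L3: "(\<lambda>n. \<mu> ^ Suc n * riemann_liouville (\<alpha> * real (Suc n)) y t) \<longlonglongrightarrow> 0"
    by (simp add: mult.assoc)
  have "(\<lambda>n. (\<Sum>j<Suc n. (\<mu> * of_real (t powr \<alpha>)) ^ j / of_real (Gamma (\<alpha> * real j + 1))) * y0
      + (\<Sum>j<Suc n. \<mu> ^ j * riemann_liouville (\<alpha> * real (Suc j)) F t)
      + \<mu> ^ Suc n * riemann_liouville (\<alpha> * real (Suc n)) y t)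
      \<longlonglongrightarrow> mittag_leffler \<alpha> 1 (\<mu> * of_real (t powr \<alpha>)) * y0
      + (LINT s|lborel. indicator {0..t} s *\<^sub>R (resolvent \<alpha> \<mu> (t - s) * F s)) + 0"
    by (intro tendsto_add tendsto_mult L1 L2 L3 tendsto_const)
  then have "(\<lambda>n::nat. y t) \<longlonglongrightarrow> mittag_leffler \<alpha> 1 (\<mu> * of_real (t powr \<alpha>)) * y0
      + (LINT s|lborel. indicator {0..t} s *\<^sub>R (resolvent \<alpha> \<mu> (t - s) * F s)) + 0"
    by (simp only: volterra_iteration[OF assms, symmetric])
  then show ?val
    using LIMSEQ_unique[OF tendsto_const] by fastforce
qed

section \<open>Convolution inequalities with a small kernel\<close>

lemma bounded_of_tendsto_at_top:
  fixes e :: "real \<Rightarrow> complex"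
  assumes e: "continuous_on {0..} e" and lim: "(e \<longlongrightarrow> 0) at_top"
  obtains M where "0 < M" "\<And>t. 0 \<le> t \<Longrightarrow> norm (e t) \<le> M"
proof -
  have "\<forall>\<^sub>F t in at_top. norm (e t) < 1"
    using tendstoD[OF lim, of 1] by simp
  then obtain T where T: "\<And>t. T \<le> t \<Longrightarrow> norm (e t) < 1"
    by (auto simp: eventually_at_top_linorder)
  obtain B where B: "0 \<le> B" "\<And>s. 0 \<le> s \<Longrightarrow> s \<le> T \<Longrightarrow> norm (e s) \<le> B"
    using continuous_bounded_Icc[OF e] by metis
  show ?thesis
  proof (rule that[of "B + 1"])
    fix t :: real
    assume "0 \<le> t"
    then show "norm (e t) \<le> B + 1"
      using T[of t] B(1) B(2)[of t] by (cases "t \<le> T") auto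
  qed (use B in simp)
qed

text \<open>
  At a point \<open>u\<close> where \<open>|y|\<close> is maximal on \<open>[0, t]\<close>, the convolution is at most \<open>|y u| / 2\<close>, which
  can be absorbed on the left.
\<close>

lemma convolution_inequality_bound:
  fixes k :: "real \<Rightarrow> real" and y :: "real \<Rightarrow> complex"
  assumes k: "integrable lborel k" "\<And>s. 0 \<le> k s" "integral\<^sup>L lborel k \<le> 1 / 2"
    and y: "continuous_on {0..} y"
    and yb: "\<And>t. 0 \<le> t \<Longrightarrow> norm (y t) \<le> A + (LINT s|lborel. indicator {0..t} s * (k (t - s) * norm (y s)))"
    and t: "0 \<le> t"
  shows "norm (y t) \<le> 2 * A"
proof -
  have "\<exists>u\<in>{0..t}. \<forall>s\<in>{0..t}. norm (y s) \<le> norm (y u)"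
    using t by (intro continuous_attains_sup continuous_intros continuous_on_subset[OF y]) auto
  then obtain u where u: "0 \<le> u" "u \<le> t" "\<And>s. 0 \<le> s \<Longrightarrow> s \<le> t \<Longrightarrow> norm (y s) \<le> norm (y u)"
    by auto
  have k': "integrable lborel (\<lambda>s. k (u + - 1 * s))"
    by (rule lborel_integrable_real_affine[OF k(1)]) simp
  have v: "(LINT s|lborel. k (u + - 1 * s)) = integral\<^sup>L lborel k"
    using lborel_integral_real_affine[of "- 1" k u] by simp
  have "(LINT s|lborel. indicator {0..u} s * (k (u - s) * norm (y s))) \<le> (LINT s|lborel. k (u + - 1 * s) * norm (y u))"
  proof (rule integral_mono')
    show "integrable lborel (\<lambda>s. k (u + - 1 * s) * norm (y u))"
      by (rule integrable_mult_left) (rule k')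
  qed (use u k in \<open>auto simp: indicator_def intro!: mult_left_mono\<close>)
  also have "\<dots> = integral\<^sup>L lborel k * norm (y u)"
    using v by simp
  also have "\<dots> \<le> 1 / 2 * norm (y u)"
    using k by (intro mult_right_mono) auto
  finally have "norm (y u) \<le> A + 1 / 2 * norm (y u)"
    using yb[OF u(1)] by linarith
  then show ?thesis using u(3)[OF t] by simp
qed

text \<open>
  If \<open>|y| \<le> b\<close> from time \<open>T\<close> on, then the part of the convolution over \<open>s \<ge> T\<close> is at most \<open>b / 2\<close>.
  The part over \<open>s < T\<close> sees only the tail of \<open>k\<close> beyond \<open>t - T\<close> and, like \<open>a t\<close>, becomes
  arbitrarily small. So \<open>|y| \<le> 3 b / 4\<close> eventually, and this improvement can be repeated.
\<close>

lemma convolution_inequality_tendsto_0: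
  fixes k a :: "real \<Rightarrow> real" and y :: "real \<Rightarrow> complex"
  assumes k: "integrable lborel k" "\<And>s. 0 \<le> k s" "integral\<^sup>L lborel k \<le> 1 / 2"
    and y: "continuous_on {0..} y" and a: "(a \<longlongrightarrow> 0) at_top"
    and yb: "\<And>t. 0 \<le> t \<Longrightarrow> norm (y t) \<le> a t + (LINT s|lborel. indicator {0..t} s * (k (t - s) * norm (y s)))"
    and bounded: "\<And>t. 0 \<le> t \<Longrightarrow> norm (y t) \<le> B"
  shows "(y \<longlongrightarrow> 0) at_top"
proof -
  have B: "0 \<le> B" using bounded[of 0] norm_ge_zero order_trans by blast
  have contract: "\<forall>\<^sub>F t in at_top. norm (y t) \<le> 3 / 4 * b"
    if b: "0 < b" and ev: "\<forall>\<^sub>F t in at_top. norm (y t) \<le> b" for b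
  proof -
    obtain T where T: "0 \<le> T" "\<And>t. T \<le> t \<Longrightarrow> norm (y t) \<le> b"
      using ev eventually_at_top_linorder[of "\<lambda>t. norm (y t) \<le> b"]
      by (metis dual_order.trans linorder_le_cases)
    define tail where "tail x = (LINT s|lborel. indicator {..x} s *\<^sub>R k s)" for x
    have tail: "(tail \<longlongrightarrow> integral\<^sup>L lborel k) at_top"
      unfolding tail_def by (rule tendsto_integral_at_top) (use k in auto)
    have "LIM t at_top. t - T :> at_top" by real_asymp
    then have "((\<lambda>t. integral\<^sup>L lborel k - tail (t - T)) \<longlongrightarrow> integral\<^sup>L lborel k - integral\<^sup>L lborel k) at_top"
      by (intro tendsto_diff tendsto_const filterlim_compose[OF tail])
    then have "((\<lambda>t. a t + (integral\<^sup>L lborel k - tail (t - T)) * B) \<longlongrightarrow> 0 + (integral\<^sup>L lborel k - integral\<^sup>L lborel k) * B) at_top"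
      by (intro tendsto_add a tendsto_mult_right)
    then have "\<forall>\<^sub>F t in at_top. a t + (integral\<^sup>L lborel k - tail (t - T)) * B < b / 4"
      by (rule order_tendstoD) (use b in simp)
    then show ?thesis
      using eventually_ge_at_top[of T]
    proof eventually_elim
      case (elim t)
      have t: "0 \<le> t" using T elim by simp
      let ?i = "\<lambda>s. indicator {..t - T} s *\<^sub>R k s"
      let ?m = "\<lambda>s. k s * b + (k s - ?i s) * B"
      have i: "integrable lborel ?i"
        by (intro integrable_mult_indicator k) auto
      have m: "integrable lborel ?m"
        by (intro Bochner_Integration.integrable_add integrable_mult_left Bochner_Integration.integrable_diff k(1) i)
      have m': "integrable lborel (\<lambda>s. ?m (t + - 1 * s))"
        by (rule lborel_integrable_real_affine[OF m]) simp
      have "(LINT s|lborel. indicator {0..t} s * (k (t - s) * norm (y s))) \<le> (LINT s|lborel. ?m (t + - 1 * s))"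
      proof (rule integral_mono'[OF m'])
        fix s
        have ks: "0 \<le> k (t - s)" by (rule k)
        show "0 \<le> ?m (t + - 1 * s)"
          using ks b B by (auto simp: indicator_def)
        show "indicator {0..t} s * (k (t - s) * norm (y s)) \<le> ?m (t + - 1 * s)"
        proof (cases "0 \<le> s \<and> s \<le> t")
          case True
          show ?thesis
          proof (cases "T \<le> s")
            case True
            then show ?thesis
              using mult_left_mono[OF T(2)[OF True] ks] \<open>0 \<le> s \<and> s \<le> t\<close> by (simp add: indicator_def)
          next
            case False
            then have "k (t - s) * norm (y s) \<le> k (t - s) * B"
              using bounded[of s] True by (intro mult_left_mono ks) auto
            moreover have "0 \<le> k (t - s) * b" using ks b by simp
            ultimately show ?thesis
              using True False by (simp add: indicator_def)
          qed
        next
          case False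
          then show ?thesis
            using ks b B by (auto simp: indicator_def)
        qed
      qed
      also have "\<dots> = integral\<^sup>L lborel ?m"
        using lborel_integral_real_affine[of "- 1" ?m t] by simp
      also have "\<dots> = integral\<^sup>L lborel k * b + (integral\<^sup>L lborel k - tail (t - T)) * B"
        using k(1) i by (simp add: tail_def)
      also have "\<dots> \<le> 1 / 2 * b + (integral\<^sup>L lborel k - tail (t - T)) * B"
        using k b by (intro add_right_mono mult_right_mono) auto
      finally show ?case using yb[OF t] elim by linarith
    qed
  qed
  have iter: "\<forall>\<^sub>F t in at_top. norm (y t) \<le> (3 / 4) ^ n * (B + 1)" for n
  proof (induction n)
    case 0
    show ?case
      using eventually_ge_at_top[of 0] by eventually_elim (use bounded in force)
  next
    case (Suc n)
    then show ?case
      using contract[of "(3 / 4) ^ n * (B + 1)"] B by (simp add: mult.assoc)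
  qed
  show ?thesis
  proof (rule tendstoI)
    fix e :: real
    assume "0 < e"
    have "(\<lambda>n. (3 / 4 :: real) ^ n * (B + 1)) \<longlonglongrightarrow> 0"
      by (intro tendsto_mult_left_zero LIMSEQ_realpow_zero) auto
    then have "\<forall>\<^sub>F n in sequentially. (3 / 4 :: real) ^ n * (B + 1) < e"
      using \<open>0 < e\<close> by (rule order_tendstoD)
    then obtain n where "(3 / 4 :: real) ^ n * (B + 1) < e"
      by (auto simp: eventually_sequentially)
    then show "\<forall>\<^sub>F t in at_top. dist (y t) 0 < e"
      using iter[of n] by (auto elim: eventually_mono)
  qed
qed

section \<open>Asymptotic stability\<close>

theorem theorem3:
  fixes \<alpha> L :: real and \<mu> :: complex and f :: "complex \<Rightarrow> complex"
  assumes "0 < \<alpha>" and "\<alpha> < 1"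
    and "f 0 = 0"
    and "L-lipschitz_on UNIV f"
    and "\<mu> \<in> stability_sector \<alpha>"
    and "ennreal L * mittag_leffler_rho \<alpha> \<mu> < 1 / 2"
  shows "origin_asymptotically_stable \<alpha> (\<lambda>z. \<mu> * z + f z)"
proof -
  have L: "0 \<le> L" using assms(4) by (rule lipschitz_on_nonneg)
  have f_le: "norm (f z) \<le> L * norm z" for z
    using lipschitz_onD[OF assms(4), of z 0] assms(3) by (simp add: dist_norm)
  define e where "e t = mittag_leffler \<alpha> 1 (\<mu> * of_real (t powr \<alpha>))" for t
  have e_lim: "(e \<longlongrightarrow> 0) at_top"
    unfolding e_def by (rule mittag_leffler_tendsto_0[OF assms(1,2,5)])
  obtain M where M: "0 < M" "\<And>t. 0 \<le> t \<Longrightarrow> norm (e t) \<le> M"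
    using bounded_of_tendsto_at_top[OF _ e_lim] continuous_mittag_leffler_curve[OF assms(1), of \<mu>]
    unfolding e_def by metis
  \<comment> \<open>Including the factor \<open>L\<close> in the kernel treats \<open>L = 0\<close>, where \<open>\<rho>\<close> may be infinite a priori, together
    with \<open>L > 0\<close>.\<close>
  define k where "k s = indicator {0..} s * (L * norm (resolvent \<alpha> \<mu> s))" for s
  have k0: "0 \<le> k s" for s using L by (simp add: k_def)
  have k_meas: "k \<in> borel_measurable lborel"
  proof -
    note [measurable] = borel_measurable_mittag_leffler[OF assms(1) assms(1)]
    show ?thesis unfolding k_def resolvent_def by measurable
  qed
  have "(\<integral>\<^sup>+ s. ennreal (k s) \<partial>lborel) = ennreal L * mittag_leffler_rho \<alpha> \<mu>"
  proof -
    note [measurable] = borel_measurable_mittag_leffler[OF assms(1) assms(1)]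
    have "ennreal (k s) = ennreal L * (ennreal (s powr (\<alpha> - 1) * norm (mittag_leffler \<alpha> \<alpha> (\<mu> * complex_of_real (s powr \<alpha>)))) * indicator {0..} s)" for s
      using L by (simp add: k_def resolvent_def indicator_def ennreal_mult)
    then show ?thesis
      unfolding mittag_leffler_rho_def by (simp add: nn_integral_cmult)
  qed
  then have nn: "(\<integral>\<^sup>+ s. ennreal (k s) \<partial>lborel) < 1 / 2" using assms(6) by simp
  have half: "(1 / 2 :: ennreal) = ennreal (1 / 2)"
    by (simp add: ennreal_divide_numeral flip: ennreal_1)
  have fin: "(\<integral>\<^sup>+ s. ennreal (k s) \<partial>lborel) < \<infinity>"
    by (rule less_trans[OF nn]) (unfold half infinity_ennreal_def, rule ennreal_less_top)
  have k_int: "integrable lborel k"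
    by (rule integrableI_nonneg) (use k_meas k0 fin in \<open>auto\<close>)
  have k_half: "integral\<^sup>L lborel k \<le> 1 / 2"
  proof -
    have "(\<integral>\<^sup>+ s. ennreal (k s) \<partial>lborel) = ennreal (integral\<^sup>L lborel k)"
      by (rule nn_integral_eq_integral[OF k_int]) (use k0 in auto)
    then have "ennreal (integral\<^sup>L lborel k) < ennreal (1 / 2)"
      using nn unfolding half by (simp only:)
    moreover have "0 \<le> integral\<^sup>L lborel k"
      by (rule Bochner_Integration.integral_nonneg) (rule k0)
    ultimately show ?thesis
      by (subst (asm) ennreal_less_iff) auto
  qed
  have main: "norm (y t) \<le> norm (e t) * norm y0 + (LINT s|lborel. indicator {0..t} s * (k (t - s) * norm (y s)))"
    and cont: "continuous_on {0..} y"
    if sol: "caputo_solution \<alpha> (\<lambda>z. \<mu> * z + f z) y0 y" and t: "0 \<le> t" for y y0 t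
  proof -
    show y: "continuous_on {0..} y" using sol by (simp add: caputo_solution_def)
    have F: "continuous_on {0..} (\<lambda>s. f (y s))"
      using continuous_on_compose2[OF lipschitz_on_continuous_on[OF assms(4)] y] by simp
    have eq: "y t = y0 + riemann_liouville \<alpha> (\<lambda>s. \<mu> * y s + f (y s)) t" if "0 \<le> t" for t
      using sol that by (simp add: caputo_solution_def riemann_liouville_def)
    note voc = variation_of_constants[OF assms(1) y F eq t]
    have "norm (LINT s|lborel. indicator {0..t} s *\<^sub>R (resolvent \<alpha> \<mu> (t - s) * f (y s)))
        \<le> (LINT s|lborel. indicator {0..t} s * (k (t - s) * norm (y s)))"
    proof (rule Bochner_Integration.integral_norm_bound_integral[OF voc(1)])
      obtain B where B: "0 \<le> B" "\<And>s. 0 \<le> s \<Longrightarrow> s \<le> t \<Longrightarrow> norm (y s) \<le> B"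
        using continuous_bounded_Icc[OF y] by metis
      show "integrable lborel (\<lambda>s. indicator {0..t} s * (k (t - s) * norm (y s)))"
      proof (rule Bochner_Integration.integrable_bound)
        show "integrable lborel (\<lambda>s. k (t + - 1 * s) * B)"
          by (rule integrable_mult_left) (rule lborel_integrable_real_affine[OF k_int], simp)
        have "(\<lambda>s. indicator {0..t} s * (k (t - s) * norm (indicator {0..} s *\<^sub>R y s))) \<in> borel_measurable lborel"
          using continuous_indicator_measurable[OF y] k_meas by measurable
        also have "(\<lambda>s. indicator {0..t} s * (k (t - s) * norm (indicator {0..} s *\<^sub>R y s))) = (\<lambda>s. indicator {0..t} s * (k (t - s) * norm (y s)))"
          by (auto simp: indicator_def fun_eq_iff)
        finally show "\<dots> \<in> borel_measurable lborel" .
        show "AE s in lborel. norm (indicator {0..t} s * (k (t - s) * norm (y s))) \<le> norm (k (t + - 1 * s) * B)"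
          using B k0 by (intro AE_I2) (auto simp: indicator_def abs_mult intro!: mult_left_mono)
      qed
      show "norm (indicator {0..t} s *\<^sub>R (resolvent \<alpha> \<mu> (t - s) * f (y s))) \<le> indicator {0..t} s * (k (t - s) * norm (y s))" for s
        using mult_left_mono[OF f_le[of "y s"], of "norm (resolvent \<alpha> \<mu> (t - s))"]
        by (auto simp: indicator_def k_def norm_mult mult_ac)
    qed
    moreover have "norm (y t) \<le> norm (e t * y0) + norm (LINT s|lborel. indicator {0..t} s *\<^sub>R (resolvent \<alpha> \<mu> (t - s) * f (y s)))"
      using voc(2) norm_triangle_ineq unfolding e_def by metis
    ultimately show "norm (y t) \<le> norm (e t) * norm y0 + (LINT s|lborel. indicator {0..t} s * (k (t - s) * norm (y s)))"
      unfolding norm_mult by linarith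
  qed
  have bnd: "norm (y t) \<le> 2 * (M * norm y0)"
    if sol: "caputo_solution \<alpha> (\<lambda>z. \<mu> * z + f z) y0 y" and t: "0 \<le> t" for y y0 t
  proof (rule convolution_inequality_bound[OF k_int k0 k_half cont[OF sol order_refl] _ t])
    fix u :: real
    assume u: "0 \<le> u"
    have "norm (e u) * norm y0 \<le> M * norm y0"
      using M(2)[OF u] by (intro mult_right_mono) auto
    then show "norm (y u) \<le> M * norm y0 + (LINT s|lborel. indicator {0..u} s * (k (u - s) * norm (y s)))"
      using main[OF sol u] by linarith
  qed
  have "origin_stable \<alpha> (\<lambda>z. \<mu> * z + f z)"
    unfolding origin_stable_def
  proof (intro allI impI)
    fix \<epsilon> :: real
    assume \<epsilon>: "0 < \<epsilon>"
    show "\<exists>\<delta>>0. \<forall>y0 y. norm y0 < \<delta> \<longrightarrow> caputo_solution \<alpha> (\<lambda>z. \<mu> * z + f z) y0 y \<longrightarrow> (\<forall>t\<ge>0. norm (y t) < \<epsilon>)"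
    proof (intro exI[of _ "\<epsilon> / (2 * M)"] conjI allI impI)
      show "0 < \<epsilon> / (2 * M)" using \<epsilon> M by simp
      fix y0 y and t :: real
      assume "norm y0 < \<epsilon> / (2 * M)" and sol: "caputo_solution \<alpha> (\<lambda>z. \<mu> * z + f z) y0 y" and t: "0 \<le> t"
      then have "2 * (M * norm y0) < \<epsilon>" using M by (simp add: field_simps)
      then show "norm (y t) < \<epsilon>" using bnd[OF sol t] by linarith
    qed
  qed
  moreover have "(y \<longlongrightarrow> 0) at_top" if sol: "caputo_solution \<alpha> (\<lambda>z. \<mu> * z + f z) y0 y" for y y0
  proof (rule convolution_inequality_tendsto_0[OF k_int k0 k_half cont[OF sol order_refl] _ main[OF sol] bnd[OF sol]])
    show "((\<lambda>t. norm (e t) * norm y0) \<longlongrightarrow> 0) at_top"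
      by (intro tendsto_mult_left_zero tendsto_norm_zero e_lim)
  qed
  then have "origin_attractive \<alpha> (\<lambda>z. \<mu> * z + f z)"
    unfolding origin_attractive_def by (intro exI[of _ 1]) auto
  ultimately show ?thesis by (simp add: origin_asymptotically_stable_def)
qed

end
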